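(* For every nonempty set $\mathcal{D}$ of discounting functions, the model-checking problem for $\mathrm{LTL}^{\mathrm{disc}\oplus}[\mathcal{D}]$ is undecidable: there is no algorithm that, given a finite Kripke structure $\mathcal{K}$, an $\mathrm{LTL}^{\mathrm{disc}\oplus}[\mathcal{D}]$ formula $\varphi$ and a threshold $v\in[0,1]$, decides whether $[\![\mathcal{K},\varphi]\!]\ge v$.
   Context: Let $AP$ be a finite set of atomic propositions. A computation is $\pi=\pi_0\pi_1\cdots\in(2^{AP})^\omega$, $\pi^i=\pi_i\pi_{i+1}\cdots$. A discounting function is a strictly decreasing $\eta:\mathbb{N}\to[0,1]$ with $\lim_{i\to\infty}\eta(i)=0$. $\mathrm{LTL}^{\mathrm{disc}\oplus}[\mathcal{D}]$ formulas: $\varphi ::= \mathtt{True}\mid p\mid\neg\varphi\mid\varphi\vee\varphi\mid\mathsf{X}\varphi\mid\varphi\,\mathsf{U}\,\varphi\mid\varphi\,\mathsf{U}_\eta\,\varphi\mid\varphi\oplus\varphi$ ($p\in AP$, $\eta\in\mathcal{D}$), with values: $[\![\pi,\mathtt{True}]\!]=1$; $[\![\pi,p]\!]=1$ if $p\in\pi_0$, else $0$; $[\![\pi,\neg\varphi]\!]=1-[\![\pi,\varphi]\!]$; $[\![\pi,\varphi\vee\psi]\!]=\max\{[\![\pi,\varphi]\!],[\![\pi,\psi]\!]\}$; $[\![\pi,\mathsf{X}\varphi]\!]=[\![\pi^1,\varphi]\!]$; $[\![\pi,\varphi\,\mathsf{U}\,\psi]\!]=\sup_{i\ge0}\min\{[\![\pi^i,\psi]\!],\min_{0\le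 j<i}[\![\pi^j,\varphi]\!]\}$; $[\![\pi,\varphi\,\mathsf{U}_\eta\,\psi]\!]=\sup_{i\ge0}\min\{\eta(i)[\![\pi^i,\psi]\!],\min_{0\le j<i}\eta(j)[\![\pi^j,\varphi]\!]\}$; $[\![\pi,\varphi\oplus\psi]\!]=\frac{[\![\pi,\varphi]\!]+[\![\pi,\psi]\!]}{2}$. A Kripke structure $\mathcal{K}=\langle AP,S,I,\rho,L\rangle$ has finite state set $S$, initial states $I\subseteq S$, total transition relation $\rho\subseteq S\times S$, labeling $L:S\to2^{AP}$; its computations are $L(s_0)L(s_1)\cdots$ for infinite paths with $s_0\in I$, $(s_i,s_{i+1})\in\rho$. $[\![\mathcal{K},\varphi]\!]=\inf\{[\![\pi,\varphi]\!]:\pi$ a computation of $\mathcal{K}\}$. *)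

theory Defs
  imports Complex_Main "HOL-Library.Nat_Bijection"
begin

definition discounting :: "(nat \<Rightarrow> real) \<Rightarrow> bool" where
  "discounting \<eta> \<longleftrightarrow>
     (\<forall>i. 0 \<le> \<eta> i \<and> \<eta> i \<le> 1) \<and>
     (\<forall>i j. i < j \<longrightarrow> \<eta> j < \<eta> i) \<and>
     (\<eta> \<longlonglongrightarrow> 0)"

section \<open>Formulas of LTL-disc-plus. Atomic propositions are naturals; the
  discounted until carries a natural-number NAME of a discounting function,
  interpreted through a naming function nat => (nat => real).\<close>

datatype form =
    TT
  | Prop nat
  | Neg form
  | Or form form
  | Next form
  | Until form form
  | DUntil nat form form
  | Avg form form

type_synonym computation = "nat \<Rightarrow> nat set"

definition suffix :: "nat \<Rightarrow> computation \<Rightarrow> computation" where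
  "suffix i \<pi> = (\<lambda>k. \<pi> (i + k))"

text \<open>The min over the (possibly empty) range j < i; since all values lie in
  [0,1], adding 1 realises the convention that the empty min is 1.\<close>
definition minlt :: "nat \<Rightarrow> (nat \<Rightarrow> real) \<Rightarrow> real" where
  "minlt i g = Min (insert 1 (g ` {..<i}))"

fun sem :: "(nat \<Rightarrow> nat \<Rightarrow> real) \<Rightarrow> computation \<Rightarrow> form \<Rightarrow> real" where
  "sem nm \<pi> TT = 1"
| "sem nm \<pi> (Prop p) = (if p \<in> \<pi> 0 then 1 else 0)"
| "sem nm \<pi> (Neg \<phi>) = 1 - sem nm \<pi> \<phi>"
| "sem nm \<pi> (Or \<phi> \<psi>) = max (sem nm \<pi> \<phi>) (sem nm \<pi> \<psi>)"
| "sem nm \<pi> (Next \<phi>) = sem nm (suffix 1 \<pi>) \<phi>"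
| "sem nm \<pi> (Until \<phi> \<psi>) =
     (SUP i. min (sem nm (suffix i \<pi>) \<psi>) (minlt i (\<lambda>j. sem nm (suffix j \<pi>) \<phi>)))"
| "sem nm \<pi> (DUntil e \<phi> \<psi>) =
     (SUP i. min (nm e i * sem nm (suffix i \<pi>) \<psi>)
                 (minlt i (\<lambda>j. nm e j * sem nm (suffix j \<pi>) \<phi>)))"
| "sem nm \<pi> (Avg \<phi> \<psi>) = (sem nm \<pi> \<phi> + sem nm \<pi> \<psi>) / 2"

section \<open>Finite Kripke structures: states 0..<kn, labels are finite sets of
  atomic propositions (so AP is finite)\<close>

record kripke =
  kn :: nat
  kinit :: "nat list"
  ktrans :: "(nat \<times> nat) list"
  klab :: "nat list list"

definition wf_kripke :: "kripke \<Rightarrow> bool" where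
  "wf_kripke K \<longleftrightarrow>
     set (kinit K) \<subseteq> {..<kn K} \<and>
     set (ktrans K) \<subseteq> {..<kn K} \<times> {..<kn K} \<and>
     length (klab K) = kn K \<and>
     (\<forall>s < kn K. \<exists>t. (s, t) \<in> set (ktrans K))"

definition computations :: "kripke \<Rightarrow> computation set" where
  "computations K =
     {\<pi>. \<exists>s. s 0 \<in> set (kinit K) \<and> (\<forall>k. (s k, s (Suc k)) \<in> set (ktrans K)) \<and>
          \<pi> = (\<lambda>k. set (klab K ! s k))}"

text \<open>Value of K: infimum over its computations (the infimum of the empty set
  in [0,1] being 1).\<close>
definition kval :: "(nat \<Rightarrow> nat \<Rightarrow> real) \<Rightarrow> kripke \<Rightarrow> form \<Rightarrow> real" where
  "kval nm K \<phi> = (if computations K = {} then 1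
                   else (INF \<pi> \<in> computations K. sem nm \<pi> \<phi>))"

datatype recf = Zf | Sf | Proj nat | Cn recf "recf list" | Pr recf recf | Mn recf

inductive reval :: "recf \<Rightarrow> nat list \<Rightarrow> nat \<Rightarrow> bool" where
  zero: "reval Zf xs 0"
| succ: "reval Sf (x # xs) (Suc x)"
| proj: "i < length xs \<Longrightarrow> reval (Proj i) xs (xs ! i)"
| comp: "list_all2 (\<lambda>g y. reval g xs y) gs ys \<Longrightarrow> reval f ys z \<Longrightarrow> reval (Cn f gs) xs z"
| pr0:  "reval f xs z \<Longrightarrow> reval (Pr f g) (0 # xs) z"
| prS:  "reval (Pr f g) (n # xs) y \<Longrightarrow> reval g (n # y # xs) z \<Longrightarrow> reval (Pr f g) (Suc n # xs) z"
| mn:   "reval f (n # xs) 0 \<Longrightarrow> (\<forall>m<n. \<exists>y. reval f (m # xs) y \<and> 0 < y) \<Longrightarrow> reval (Mn f) xs n"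

fun enc_form :: "form \<Rightarrow> nat" where
  "enc_form TT = prod_encode (0, 0)"
| "enc_form (Prop p) = prod_encode (1, p)"
| "enc_form (Neg \<phi>) = prod_encode (2, enc_form \<phi>)"
| "enc_form (Or \<phi> \<psi>) = prod_encode (3, prod_encode (enc_form \<phi>, enc_form \<psi>))"
| "enc_form (Next \<phi>) = prod_encode (4, enc_form \<phi>)"
| "enc_form (Until \<phi> \<psi>) = prod_encode (5, prod_encode (enc_form \<phi>, enc_form \<psi>))"
| "enc_form (DUntil e \<phi> \<psi>) = prod_encode (6, prod_encode (e, prod_encode (enc_form \<phi>, enc_form \<psi>)))"
| "enc_form (Avg \<phi> \<psi>) = prod_encode (7, prod_encode (enc_form \<phi>, enc_form \<psi>))"

definition enc_kripke :: "kripke \<Rightarrow> nat" where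
  "enc_kripke K = list_encode [kn K, list_encode (kinit K),
     list_encode (map prod_encode (ktrans K)), list_encode (map list_encode (klab K))]"

text \<open>An instance: Kripke structure, formula, threshold v = p / q.\<close>
definition enc_instance :: "kripke \<Rightarrow> form \<Rightarrow> nat \<Rightarrow> nat \<Rightarrow> nat" where
  "enc_instance K \<phi> p q = list_encode [enc_kripke K, enc_form \<phi>, p, q]"

end

theory Submission
  imports Defs
begin

text \<open>A discounted until measures time: with \<open>\<eta>\<close> strictly decreasing and positive, the value of
  \<open>True U\<^sub>\<eta> p\<close> is \<open>\<eta> d\<close>, where \<open>d\<close> is the distance to the first \<open>p\<close> (and \<open>0\<close> if there is none).
  Averaging such a value with the negation of another one gives at least \<open>1/2\<close> iff the first distance
  is at most the second one, whatever \<open>\<eta>\<close> is. So a formula can compare the registers of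
  successive configurations of a counter machine, encoded as distances, and there is a formula
  with value below \<open>1/2\<close> on exactly the computations that describe a halting run. The inputs enter
  the formula only through nested \<open>X\<close> operators, so this reduction is primitive recursive. Given a
  supposed decision procedure \<open>f\<close>, take the machine that halts on the codes \<open>a\<close> of a Kripke structure
  and \<open>b\<close> of a formula iff \<open>f\<close> answers \<open>1\<close> on the instance built from \<open>a\<close> and \<open>b\<close>; running it on
  the codes of its own Kripke structure and formula refutes \<open>f\<close>.\<close>

section \<open>Recursive functions\<close>

text \<open>In the \<open>Mn\<close> case two distinct results would give the smaller argument both
  the value 0 and a positive value.\<close>

lemma reval_det: "reval f xs y \<Longrightarrow> reval f xs z \<Longrightarrow> y = z"
proof (induction arbitrary: z rule: reval.induct)
  case (zero xs) then show ?case by (cases rule: reval.cases) auto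
next
  case (succ x xs) from succ show ?case by (cases rule: reval.cases) auto
next
  case (proj i xs) from proj(2) show ?case by (cases rule: reval.cases) auto
next
  case (comp xs gs ys f z')
  from comp.prems show ?case
  proof (cases rule: reval.cases)
    case (comp ys')
    have "ys = ys'"
      using comp(1) \<open>list_all2 (\<lambda>g y. reval g xs y \<and> (\<forall>z. reval g xs z \<longrightarrow> y = z)) gs ys\<close>
      by (intro nth_equalityI) (auto simp: list_all2_conv_all_nth)
    then show ?thesis using comp(2) \<open>\<And>z. reval f ys z \<Longrightarrow> z' = z\<close> by blast
  qed
next
  case (pr0 f xs z g) from pr0.prems show ?case
    by (cases rule: reval.cases) (auto dest: pr0.IH)
next
  case (prS f g n xs y z) from prS.prems show ?case
    by (cases rule: reval.cases) (auto dest: prS.IH)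
next
  case (mn f n xs)
  from mn.prems show ?case
  proof (cases rule: reval.cases)
    case mn': mn
    show ?thesis
    proof (cases n z rule: linorder_cases)
      case less
      with mn'(2) mn.IH(1) show ?thesis by fastforce
    next
      case greater
      with mn'(1) mn.IH(2) show ?thesis by fastforce
    qed
  qed
qed

lemma reval_Zf_iff: "reval Zf xs y \<longleftrightarrow> y = 0"
  by (auto intro: reval.zero elim: reval.cases)

lemma reval_Sf_iff: "reval Sf xs y \<longleftrightarrow> (\<exists>x xs'. xs = x # xs' \<and> y = Suc x)"
  by (auto intro: reval.succ elim: reval.cases)

lemma reval_Proj_iff: "reval (Proj i) xs y \<longleftrightarrow> i < length xs \<and> y = xs ! i"
  by (auto intro: reval.proj elim: reval.cases)

lemma reval_Cn_iff:
  "reval (Cn f gs) xs z \<longleftrightarrow> (\<exists>ys. list_all2 (\<lambda>g y. reval g xs y) gs ys \<and> reval f ys z)"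
  by (auto intro: reval.comp elim: reval.cases)

lemma reval_Pr_0_iff: "reval (Pr f g) (0 # xs) z \<longleftrightarrow> reval f xs z"
  by (auto intro: reval.pr0 elim: reval.cases)

lemma reval_Pr_Suc_iff:
  "reval (Pr f g) (Suc n # xs) z \<longleftrightarrow> (\<exists>y. reval (Pr f g) (n # xs) y \<and> reval g (n # y # xs) z)"
  by (auto intro: reval.prS elim: reval.cases)

lemma not_reval_Pr_Nil: "\<not> reval (Pr f g) [] z"
  by (auto elim: reval.cases)

lemma reval_Mn_iff:
  "reval (Mn f) xs n \<longleftrightarrow> reval f (n # xs) 0 \<and> (\<forall>m<n. \<exists>y. reval f (m # xs) y \<and> 0 < y)"
  by (auto intro: reval.mn elim: reval.cases)

section \<open>Arithmetic and Cantor pairing as recursive functions\<close>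

lemma reval_Cn1: "reval g xs y \<Longrightarrow> reval f [y] z \<Longrightarrow> reval (Cn f [g]) xs z"
  by (rule reval.comp[where ys = "[y]"]) auto

lemma reval_Cn2:
  "reval g xs y \<Longrightarrow> reval h xs y' \<Longrightarrow> reval f [y, y'] z \<Longrightarrow> reval (Cn f [g, h]) xs z"
  by (rule reval.comp[where ys = "[y, y']"]) auto

fun const_recf :: "nat \<Rightarrow> recf" where
  "const_recf 0 = Zf"
| "const_recf (Suc n) = Cn Sf [const_recf n]"

lemma reval_const: "reval (const_recf n) xs n"
  by (induction n) (auto intro: reval.zero reval.succ reval_Cn1)

definition add_recf :: recf where
  "add_recf = Pr (Proj 0) (Cn Sf [Proj 1])"

lemma reval_add: "reval add_recf [m, n] (m + n)"
  unfolding add_recf_def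
  by (induction m) (auto simp: reval_Pr_0_iff reval_Pr_Suc_iff reval_Proj_iff
      intro!: reval_Cn1 reval.succ)

definition triangle_recf :: recf where
  "triangle_recf = Pr Zf (Cn add_recf [Proj 1, Cn Sf [Proj 0]])"

lemma reval_triangle: "reval triangle_recf [n] (triangle n)"
proof (induction n)
  case 0
  then show ?case by (simp add: triangle_recf_def reval_Pr_0_iff reval_Zf_iff)
next
  case (Suc n)
  have "reval (Cn add_recf [Proj 1, Cn Sf [Proj 0]]) [n, triangle n] (triangle n + Suc n)"
    by (rule reval_Cn2[OF _ reval_Cn1[OF _ reval.succ] reval_add])
      (simp_all add: reval_Proj_iff)
  with Suc show ?case by (auto simp: triangle_recf_def reval_Pr_Suc_iff)
qed

text \<open>The Cantor pairing behind \<open>prod_encode\<close>: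
  \<open>triangle (m + n) + m\<close>.\<close>

definition pair_recf :: "recf \<Rightarrow> recf \<Rightarrow> recf" where
  "pair_recf g h = Cn add_recf [Cn triangle_recf [Cn add_recf [g, h]], g]"

lemma reval_pair:
  assumes "reval g xs m" "reval h xs n"
  shows "reval (pair_recf g h) xs (prod_encode (m, n))"
  unfolding pair_recf_def prod_encode_def prod.case
  by (rule reval_Cn2[OF reval_Cn1[OF reval_Cn2[OF assms reval_add] reval_triangle] assms(1) reval_add])

section \<open>Nondeterministic register programs\<close>

type_synonym store = "nat \<Rightarrow> nat"

text \<open>There is no decrement and no branching: values are guessed and then checked with
  \<open>Eq\<close>, which leaves few kinds of transition for a formula to express.\<close>

datatype act = Zero nat | Inc nat | Eq nat nat

fun step :: "act \<Rightarrow> store \<Rightarrow> store \<Rightarrow> bool" where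
  "step (Zero r) s s' \<longleftrightarrow> s' = s(r := 0)"
| "step (Inc r) s s' \<longleftrightarrow> s' = s(r := Suc (s r))"
| "step (Eq u v) s s' \<longleftrightarrow> s u = s v \<and> s' = s"

datatype prog = Act act | Seq prog prog (infixr ";;" 65) | Star prog

fun psem :: "prog \<Rightarrow> (store \<times> store) set" where
  "psem (Act a) = {(s, s'). step a s s'}"
| "psem (\<alpha> ;; \<beta>) = psem \<alpha> O psem \<beta>"
| "psem (Star \<alpha>) = (psem \<alpha>)\<^sup>*"

definition havoc :: "nat \<Rightarrow> prog" where
  "havoc r = Act (Zero r) ;; Star (Act (Inc r))"

lemma psem_havoc: "(s, s') \<in> psem (havoc r) \<longleftrightarrow> (\<exists>x. s' = s(r := x))"
proof -
  have 1: "\<exists>x. s' = s(r := x)" if "(s, s') \<in> {(s, s'). step (Inc r) s s'}\<^sup>*" for s s'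
    using that
  proof (induction rule: rtrancl_induct)
    case base
    show ?case by (metis fun_upd_triv)
  next
    case (step t u)
    then show ?case by (metis (mono_tags, lifting) case_prodD fun_upd_upd mem_Collect_eq step.simps(2))
  qed
  have 2: "(s(r := 0), s(r := x)) \<in> {(s, s'). step (Inc r) s s'}\<^sup>*" for s x
  proof (induction x)
    case (Suc x)
    have "(s(r := x), s(r := Suc x)) \<in> {(s, s'). step (Inc r) s s'}" by simp
    with Suc show ?case by (rule rtrancl_into_rtrancl)
  qed simp
  have "(s, s') \<in> psem (havoc r) \<longleftrightarrow> (s(r := 0), s') \<in> {(s, s'). step (Inc r) s s'}\<^sup>*"
    by (simp add: havoc_def relcomp_unfold del: step.simps(2))
  moreover have "(s(r := 0), s') \<in> {(s, s'). step (Inc r) s s'}\<^sup>* \<longleftrightarrow> (\<exists>x. s' = s(r := x))"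
    using 1[of "s(r := 0)" s'] 2[of s] by auto
  ultimately show ?thesis by simp
qed

definition copy :: "nat \<Rightarrow> nat \<Rightarrow> prog" where
  "copy r u = havoc r ;; Act (Eq r u)"

lemma psem_copy: "r \<noteq> u \<Longrightarrow> (s, s') \<in> psem (copy r u) \<longleftrightarrow> s' = s(r := s u)"
  by (auto simp: copy_def relcomp_unfold psem_havoc)

text \<open>Ends in the test 1 = 0, so no run survives.\<close>

definition fail :: "nat \<Rightarrow> prog" where
  "fail t = Act (Zero t) ;; Act (Inc t) ;; Act (Zero (Suc t)) ;; Act (Eq t (Suc t))"

lemma psem_fail: "psem (fail t) = {}"
  by (auto simp: fail_def)

definition is_zero :: "nat \<Rightarrow> nat \<Rightarrow> prog" where
  "is_zero u t = Act (Zero t) ;; Act (Eq t u)"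

lemma psem_is_zero: "t \<noteq> u \<Longrightarrow> (s, s') \<in> psem (is_zero u t) \<longleftrightarrow> s u = 0 \<and> s' = s(t := 0)"
  by (auto simp: is_zero_def relcomp_unfold)

definition is_pos :: "nat \<Rightarrow> nat \<Rightarrow> prog" where
  "is_pos u t = havoc t ;; Act (Inc t) ;; Act (Eq t u)"

lemma psem_is_pos:
  assumes "t \<noteq> u"
  shows "(s, s') \<in> psem (is_pos u t) \<longleftrightarrow> 0 < s u \<and> s' = s(t := s u)"
proof -
  have "(s(t := x), s') \<in> psem (Act (Inc t) ;; Act (Eq t u)) \<longleftrightarrow> Suc x = s u \<and> s' = s(t := Suc x)" for x
    using assms by (auto simp: relcomp_unfold)
  moreover have "(s, s') \<in> psem (is_pos u t) \<longleftrightarrow>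
      (\<exists>x. (s(t := x), s') \<in> psem (Act (Inc t) ;; Act (Eq t u)))"
    unfolding is_pos_def psem.simps(2)[of "havoc t"] relcomp_unfold
    by (auto simp: psem_havoc simp del: psem.simps)
  ultimately have "(s, s') \<in> psem (is_pos u t) \<longleftrightarrow> (\<exists>x. Suc x = s u \<and> s' = s(t := Suc x))"
    by simp
  then show ?thesis by (metis gr0_conv_Suc)
qed

text \<open>Here \<open>i\<close> is the register of the next result and \<open>m\<close> the start
  of the scratch space; \<open>Eq 0 0\<close> serves as the program that does nothing.\<close>

fun cseq :: "(nat \<Rightarrow> nat \<Rightarrow> prog) list \<Rightarrow> nat \<Rightarrow> nat \<Rightarrow> prog" where
  "cseq [] i m = Act (Eq 0 0)"
| "cseq (c # cs) i m = c i m ;; cseq cs (Suc i) m"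

text \<open>\<open>rcomp f rs r m\<close> evaluates \<open>f\<close> on the registers \<open>rs\<close>, leaves the result in register \<open>r\<close>
  and uses the registers from \<open>m\<close> upwards as scratch space, whose initial contents are irrelevant.\<close>

fun rcomp :: "recf \<Rightarrow> nat list \<Rightarrow> nat \<Rightarrow> nat \<Rightarrow> prog" where
  "rcomp Zf rs r m = Act (Zero r)"
| "rcomp Sf rs r m = (case rs of [] \<Rightarrow> fail m | u # _ \<Rightarrow> copy r u ;; Act (Inc r))"
| "rcomp (Proj i) rs r m = (if i < length rs then copy r (rs ! i) else fail m)"
| "rcomp (Cn f gs) rs r m =
     cseq (map (\<lambda>g. rcomp g rs) gs) m (m + length gs) ;;
     rcomp f [m..<m + length gs] r (m + length gs)"
| "rcomp (Pr f g) rs r m = (case rs of [] \<Rightarrow> fail m | u # us \<Rightarrow>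
     rcomp f us (m + 1) (m + 3) ;; Act (Zero m) ;;
     Star (rcomp g (m # (m + 1) # us) (m + 2) (m + 3) ;; copy (m + 1) (m + 2) ;; Act (Inc m)) ;;
     Act (Eq m u) ;; copy r (m + 1))"
| "rcomp (Mn f) rs r m =
     Act (Zero m) ;;
     Star (rcomp f (m # rs) (m + 1) (m + 2) ;; is_pos (m + 1) (m + 2) ;; Act (Inc m)) ;;
     rcomp f (m # rs) (m + 1) (m + 2) ;; is_zero (m + 1) (m + 2) ;; copy r m"

section \<open>Correctness of the compilation\<close>

definition agree :: "nat \<Rightarrow> store \<Rightarrow> store \<Rightarrow> bool" where
  "agree m s t \<longleftrightarrow> (\<forall>i<m. s i = t i)"

lemma agreeD: "agree m s t \<Longrightarrow> i < m \<Longrightarrow> s i = t i"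
  by (simp add: agree_def)

lemma agree_map: "agree m s t \<Longrightarrow> set rs \<subseteq> {..<m} \<Longrightarrow> map s rs = map t rs"
  by (auto simp: agree_def)

text \<open>Only terminating runs count: each must give a right result, and each result must be
  reached by some run. Divergence of a function thus becomes absence of runs, and wrong guesses do
  no harm.\<close>

definition implements :: "prog \<Rightarrow> (nat list \<Rightarrow> nat \<Rightarrow> bool) \<Rightarrow> nat list \<Rightarrow> nat \<Rightarrow> nat \<Rightarrow> bool" where
  "implements \<alpha> F rs r m \<longleftrightarrow>
     (\<forall>s s'. (s, s') \<in> psem \<alpha> \<longrightarrow> F (map s rs) (s' r) \<and> agree m s' (s(r := s' r))) \<and>
     (\<forall>s y. F (map s rs) y \<longrightarrow> (\<exists>s'. (s, s') \<in> psem \<alpha> \<and> agree m s' (s(r := y))))"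

lemma implements_sound:
  assumes "implements \<alpha> F rs r m" "(s, s') \<in> psem \<alpha>"
  shows "F (map s rs) (s' r)" "\<And>i. i < m \<Longrightarrow> i \<noteq> r \<Longrightarrow> s' i = s i"
proof -
  from assms have "F (map s rs) (s' r) \<and> agree m s' (s(r := s' r))"
    unfolding implements_def by simp
  then show "F (map s rs) (s' r)" "\<And>i. i < m \<Longrightarrow> i \<noteq> r \<Longrightarrow> s' i = s i"
    by (auto dest: agreeD)
qed

lemma implements_complete:
  assumes "implements \<alpha> F rs r m" "F (map s rs) y"
  obtains s' where "(s, s') \<in> psem \<alpha>" "agree m s' (s(r := y))"
proof -
  from assms(1) have "F (map s rs) y \<longrightarrow> (\<exists>s'. (s, s') \<in> psem \<alpha> \<and> agree m s' (s(r := y)))"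
    unfolding implements_def by (elim conjE allE)
  with assms(2) that show thesis by blast
qed

text \<open>Keeping \<open>r\<close> apart from \<open>rs\<close> ensures that writing the result
  overwrites no argument.\<close>

definition correct :: "recf \<Rightarrow> bool" where
  "correct f \<longleftrightarrow> (\<forall>rs r m. set rs \<subseteq> {..<m} \<longrightarrow> r < m \<longrightarrow> r \<notin> set rs \<longrightarrow>
     implements (rcomp f rs r m) (reval f) rs r m)"

lemma correctD:
  "correct f \<Longrightarrow> set rs \<subseteq> {..<m} \<Longrightarrow> r < m \<Longrightarrow> r \<notin> set rs \<Longrightarrow>
    implements (rcomp f rs r m) (reval f) rs r m"
  by (simp add: correct_def)

lemma correct_basic: "correct Zf" "correct Sf" "correct (Proj i)"
proof -
  show "correct Zf"
    by (auto simp: correct_def implements_def reval_Zf_iff agree_def)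
  have "implements (rcomp Sf rs r m) (reval Sf) rs r m"
    if "r \<notin> set rs" for rs r m
    using that by (cases rs) (auto simp: implements_def reval_Sf_iff psem_fail psem_copy agree_def relcomp_unfold)
  then show "correct Sf" by (simp add: correct_def)
  have "implements (rcomp (Proj i) rs r m) (reval (Proj i)) rs r m"
    if "r \<notin> set rs" for rs r m
  proof (cases "i < length rs")
    case True
    with that have "r \<noteq> rs ! i" by auto
    with True show ?thesis by (auto simp: implements_def reval_Proj_iff psem_copy agree_def)
  qed (auto simp: implements_def reval_Proj_iff psem_fail)
  then show "correct (Proj i)" by (simp add: correct_def)
qed

text \<open>The target \<open>i\<close> climbs towards the fixed scratch bound \<open>m\<close>. As
  all arguments lie below \<open>n \<le> i\<close>, neither they nor earlier results are
  overwritten.\<close>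

lemma cseq_sound:
  assumes "\<forall>g\<in>set gs. correct g" "i + length gs = m" "set rs \<subseteq> {..<n}" "n \<le> i"
    "(s, s') \<in> psem (cseq (map (\<lambda>g. rcomp g rs) gs) i m)"
  shows "list_all2 (\<lambda>g y. reval g (map s rs) y) gs (map s' [i..<m]) \<and> agree i s' s"
  using assms
proof (induction gs arbitrary: i s)
  case Nil
  then show ?case by (simp add: agree_def)
next
  case (Cons g gs)
  from Cons.prems(5) obtain t where t: "(s, t) \<in> psem (rcomp g rs i m)"
    "(t, s') \<in> psem (cseq (map (\<lambda>g. rcomp g rs) gs) (Suc i) m)" by auto
  have "implements (rcomp g rs i m) (reval g) rs i m"
    using Cons.prems by (intro correctD) auto
  note 1 = implements_sound[OF this t(1)]
  have 2: "list_all2 (\<lambda>g y. reval g (map t rs) y) gs (map s' [Suc i..<m]) \<and> agree (Suc i) s' t"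
    using Cons.prems(1-4) t by (intro Cons.IH) auto
  have 3: "map t rs = map s rs"
    using 1(2) Cons.prems by (auto simp: agree_def)
  have "agree i t s" using 1(2) Cons.prems(2) by (auto simp: agree_def)
  with conjunct2[OF 2] have "agree i s' s" "s' i = t i" by (auto simp: agree_def)
  moreover have "[i..<m] = i # [Suc i..<m]" using Cons.prems(2) by (simp add: upt_conv_Cons)
  ultimately show ?case using 1(1) 2[unfolded 3] by simp
qed

lemma cseq_complete:
  assumes "\<forall>g\<in>set gs. correct g" "i + length gs = m" "set rs \<subseteq> {..<n}" "n \<le> i"
    "list_all2 (\<lambda>g y. reval g (map s rs) y) gs ys"
  shows "\<exists>s'. (s, s') \<in> psem (cseq (map (\<lambda>g. rcomp g rs) gs) i m) \<and> map s' [i..<m] = ys \<and> agree i s' s"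
  using assms
proof (induction gs arbitrary: i s ys)
  case Nil
  then show ?case by (simp add: agree_def)
next
  case (Cons g gs)
  from Cons.prems(5) obtain y ys' where ys: "ys = y # ys'" "reval g (map s rs) y"
    "list_all2 (\<lambda>g y. reval g (map s rs) y) gs ys'" by (auto simp: list_all2_Cons1)
  have "implements (rcomp g rs i m) (reval g) rs i m"
    using Cons.prems by (intro correctD) auto
  from implements_complete[of _ "reval g", OF this ys(2)] obtain t
    where t: "(s, t) \<in> psem (rcomp g rs i m)" "agree m t (s(i := y))" .
  have 3: "map t rs = map s rs"
    using t(2) Cons.prems by (auto simp: agree_def)
  have "\<exists>s'. (t, s') \<in> psem (cseq (map (\<lambda>g. rcomp g rs) gs) (Suc i) m)
      \<and> map s' [Suc i..<m] = ys' \<and> agree (Suc i) s' t"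
    using Cons.prems(1-4) ys(3)[folded 3] by (intro Cons.IH) auto
  then obtain s' where s': "(t, s') \<in> psem (cseq (map (\<lambda>g. rcomp g rs) gs) (Suc i) m)"
      "map s' [Suc i..<m] = ys'" "agree (Suc i) s' t" by blast
  moreover have "[i..<m] = i # [Suc i..<m]" using Cons.prems(2) by (simp add: upt_conv_Cons)
  moreover have "agree i t s" "t i = y" using t(2) Cons.prems(2) by (auto simp: agree_def)
  then have "agree i s' s" "s' i = y" using s'(3) by (auto simp: agree_def)
  ultimately show ?case using t ys(1) by auto
qed

lemma correct_Cn:
  assumes f: "correct f" and gs: "\<forall>g\<in>set gs. correct g"
  shows "correct (Cn f gs)"
  unfolding correct_def implements_def
proof (intro allI impI conjI)
  fix rs and r m :: nat and s
  assume r: "set rs \<subseteq> {..<m}" "r < m" "r \<notin> set rs"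
  define m' where "m' = m + length gs"
  have P: "rcomp (Cn f gs) rs r m =
    cseq (map (\<lambda>g. rcomp g rs) gs) m m' ;; rcomp f [m..<m'] r m'"
    by (simp add: m'_def)
  have I: "implements (rcomp f [m..<m'] r m') (reval f) [m..<m'] r m'"
    using f r by (intro correctD) (auto simp: m'_def)
  {
    fix s' assume "(s, s') \<in> psem (rcomp (Cn f gs) rs r m)"
    then obtain t where t: "(s, t) \<in> psem (cseq (map (\<lambda>g. rcomp g rs) gs) m m')"
      "(t, s') \<in> psem (rcomp f [m..<m'] r m')" unfolding P by auto
    note 1 = cseq_sound[OF gs m'_def[symmetric] r(1) order_refl t(1)]
    note 2 = implements_sound[OF I t(2)]
    show "reval (Cn f gs) (map s rs) (s' r)" 
      unfolding reval_Cn_iff using conjunct1[OF 1] 2(1) by blast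
    show "agree m s' (s(r := s' r))" 
      using conjunct2[OF 1] 2(2) by (simp add: agree_def m'_def)
  next
    fix y assume "reval (Cn f gs) (map s rs) y"
    then obtain ys where ys: "list_all2 (\<lambda>g y. reval g (map s rs) y) gs ys" "reval f ys y"
      by (auto simp: reval_Cn_iff)
    from cseq_complete[OF gs m'_def[symmetric] r(1) order_refl ys(1)] obtain t
      where t: "(s, t) \<in> psem (cseq (map (\<lambda>g. rcomp g rs) gs) m m')" "map t [m..<m'] = ys" "agree m t s"
      by blast
    from implements_complete[of _ "reval f", OF I ys(2)[folded t(2)]] obtain s'
      where "(t, s') \<in> psem (rcomp f [m..<m'] r m')" "agree m' s' (t(r := y))" .
    moreover from this(2) t(3) have "agree m s' (s(r := y))" by (simp add: agree_def m'_def)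
    ultimately show "\<exists>s'. (s, s') \<in> psem (rcomp (Cn f gs) rs r m) \<and> agree m s' (s(r := y))"
      unfolding P using t(1) by auto
  }
qed


text \<open>Register \<open>m\<close> is the candidate and \<open>m + 1\<close> the value of
  \<open>f\<close> there. The loop may be left at any time, but the closing \<open>is_zero\<close>
  admits only the right exit.\<close>

lemma correct_Mn:
  assumes f: "correct f"
  shows "correct (Mn f)"
  unfolding correct_def implements_def
proof (intro allI impI conjI)
  fix rs and r m :: nat and s
  assume r: "set rs \<subseteq> {..<m}" "r < m" "r \<notin> set rs"
  define \<phi> where "\<phi> = rcomp f (m # rs) (m + 1) (m + 2)"
  define \<beta> where "\<beta> = \<phi> ;; is_pos (m + 1) (m + 2) ;; Act (Inc m)"
  have P: "rcomp (Mn f) rs r m =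
      Act (Zero m) ;; Star \<beta> ;; \<phi> ;; is_zero (m + 1) (m + 2) ;; copy r m"
    by (simp add: \<phi>_def \<beta>_def)
  have I: "implements \<phi> (reval f) (m # rs) (m + 1) (m + 2)"
    unfolding \<phi>_def using f r by (intro correctD) auto
  have map: "map t rs = map s rs" if "agree m t s" for t
    using that r(1) by (rule agree_map)
  have \<beta>: "(t, u) \<in> psem \<beta> \<longleftrightarrow> (\<exists>v. (t, v) \<in> psem \<phi> \<and> 0 < v (m + 1) \<and>
      u = v(m + 2 := v (m + 1), m := Suc (v m)))" for t u
    by (auto simp: \<beta>_def relcomp_unfold psem_is_pos)
  {
    fix s' assume "(s, s') \<in> psem (rcomp (Mn f) rs r m)"
    then obtain t u where t: "(s(m := 0), t) \<in> (psem \<beta>)\<^sup>*" "(t, u) \<in> psem \<phi>"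
      "u (m + 1) = 0" "s' = u(m + 2 := 0, r := u m)"
      using r(2) unfolding P by (auto simp: relcomp_unfold psem_is_zero psem_copy)
    from t(1) have "agree m t s \<and> (\<forall>j<t m. \<exists>y. reval f (j # map s rs) y \<and> 0 < y)"
    proof (induction rule: rtrancl_induct)
      case base
      then show ?case by (simp add: agree_def)
    next
      case (step t u)
      from step.hyps(2) obtain v where v: "(t, v) \<in> psem \<phi>" "0 < v (m + 1)"
        "u = v(m + 2 := v (m + 1), m := Suc (v m))" unfolding \<beta> by blast
      note S = implements_sound[OF I v(1)]
      have "v m = t m" "agree m v t" using S(2) by (auto simp: agree_def)
      moreover have "reval f (t m # map s rs) (v (m + 1))"
        using S(1) unfolding list.map map[OF conjunct1[OF step.IH]] .
      ultimately show ?case using step.IH v(2,3)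
        by (auto simp: agree_def less_Suc_eq)
    qed
    note t' = conjunct1[OF this] conjunct2[OF this]
    note S = implements_sound[OF I t(2)]
    have u: "u m = t m" "agree m u t" using S(2) by (auto simp: agree_def)
    have "reval f (t m # map s rs) 0" using S(1) unfolding list.map map[OF t'(1)] t(3) .
    with t'(2) have "reval (Mn f) (map s rs) (t m)" by (simp add: reval_Mn_iff)
    then show "reval (Mn f) (map s rs) (s' r)" using u t(4) by simp
    show "agree m s' (s(r := s' r))" using u t(4) t'(1) by (auto simp: agree_def)
  next
    fix y assume "reval (Mn f) (map s rs) y"
    then have y: "reval f (y # map s rs) 0" "\<And>j. j < y \<Longrightarrow> \<exists>v. reval f (j # map s rs) v \<and> 0 < v"
      by (auto simp: reval_Mn_iff)
    have "\<exists>t. (s(m := 0), t) \<in> (psem \<beta>)\<^sup>* \<and> agree m t s \<and> t m = j" if "j \<le> y" for j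
      using that
    proof (induction j)
      case 0
      then show ?case by (intro exI[of _ "s(m := 0)"] conjI) (auto simp: agree_def)
    next
      case (Suc j)
      then obtain t where t: "(s(m := 0), t) \<in> (psem \<beta>)\<^sup>*" "agree m t s" "t m = j"
        using Suc_leD by blast
      from y(2)[of j] Suc.prems obtain v where v: "reval f (j # map s rs) v" "0 < v" by auto
      from v(1) have "reval f (map t (m # rs)) v" unfolding list.map map[OF t(2)] t(3) .
      from implements_complete[of _ "reval f", OF I this] obtain u
        where u: "(t, u) \<in> psem \<phi>" "agree (m + 2) u (t(m + 1 := v))" .
      define w where "w = u(m + 2 := u (m + 1), m := Suc (u m))"
      have u': "u (m + 1) = v" "u m = t m" "agree m u t" using u(2) by (auto simp: agree_def)
      then have "(t, w) \<in> psem \<beta>"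
        unfolding \<beta> w_def using u(1) v(2) by blast
      with t(1) have "(s(m := 0), w) \<in> (psem \<beta>)\<^sup>*" by (rule rtrancl_into_rtrancl)
      moreover have "agree m w s" "w m = Suc j"
        using u' t(2,3) by (auto simp: w_def agree_def)
      ultimately show ?case by blast
    qed
    then obtain t where t: "(s(m := 0), t) \<in> (psem \<beta>)\<^sup>*" "agree m t s" "t m = y" by blast
    from y(1) have "reval f (map t (m # rs)) 0" unfolding list.map map[OF t(2)] t(3) .
    from implements_complete[of _ "reval f", OF I this] obtain u
      where u: "(t, u) \<in> psem \<phi>" "agree (m + 2) u (t(m + 1 := 0))" .
    have u': "u (m + 1) = 0" "u m = y" "agree m u t" using u(2) t(3) by (auto simp: agree_def)
    have "(s, u(m + 2 := 0, r := u m)) \<in> psem (rcomp (Mn f) rs r m)"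
      unfolding P using r(2) t(1) u(1) u'(1) by (auto simp: relcomp_unfold psem_is_zero psem_copy)
    moreover have "agree m (u(m + 2 := 0, r := u m)) (s(r := y))"
      using u' t(2) by (auto simp: agree_def)
    ultimately show "\<exists>s'. (s, s') \<in> psem (rcomp (Mn f) rs r m) \<and> agree m s' (s(r := y))" by blast
  }
qed

text \<open>Register \<open>m\<close> is the recursion counter, \<open>m + 1\<close> the accumulator
  and \<open>m + 2\<close> the next value. The number of iterations is guessed and checked by
  \<open>Eq m u\<close>.\<close>

lemma correct_Pr:
  assumes f: "correct f" and g: "correct g"
  shows "correct (Pr f g)"
  unfolding correct_def
proof (intro allI impI)
  fix rs and r m :: nat
  assume r: "set rs \<subseteq> {..<m}" "r < m" "r \<notin> set rs"
  show "implements (rcomp (Pr f g) rs r m) (reval (Pr f g)) rs r m"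
  proof (cases rs)
    case Nil
    then show ?thesis by (simp add: implements_def psem_fail not_reval_Pr_Nil)
  next
    case (Cons u us)
    define \<phi> where "\<phi> = rcomp f us (m + 1) (m + 3)"
    define \<gamma> where "\<gamma> = rcomp g (m # (m + 1) # us) (m + 2) (m + 3)"
    define \<beta> where "\<beta> = \<gamma> ;; copy (m + 1) (m + 2) ;; Act (Inc m)"
    have P: "rcomp (Pr f g) rs r m =
        \<phi> ;; Act (Zero m) ;; Star \<beta> ;; Act (Eq m u) ;; copy r (m + 1)"
      by (simp add: \<phi>_def \<gamma>_def \<beta>_def Cons)
    have us: "set us \<subseteq> {..<m}" "u < m" using r Cons by auto
    have I: "implements \<phi> (reval f) us (m + 1) (m + 3)"
      unfolding \<phi>_def using f us by (intro correctD) auto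
    have J: "implements \<gamma> (reval g) (m # (m + 1) # us) (m + 2) (m + 3)"
      unfolding \<gamma>_def using g us by (intro correctD) auto
    have map: "map t us = map s us" if "agree m t s" for t s
      using that us(1) by (rule agree_map)
    have \<beta>: "(t, w) \<in> psem \<beta> \<longleftrightarrow> (\<exists>v. (t, v) \<in> psem \<gamma> \<and>
        w = v(m + 1 := v (m + 2), m := Suc (v m)))" for t w
      by (auto simp: \<beta>_def relcomp_unfold psem_copy)
    show ?thesis
      unfolding implements_def
    proof (intro allI impI conjI)
      fix s s' assume "(s, s') \<in> psem (rcomp (Pr f g) rs r m)"
      then obtain p t where t: "(s, p) \<in> psem \<phi>" "(p(m := 0), t) \<in> (psem \<beta>)\<^sup>*"
        "t m = t u" "s' = t(r := t (m + 1))"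
        using r(2) unfolding P by (auto simp: relcomp_unfold psem_copy)
      note S = implements_sound[OF I t(1)]
      \<comment> \<open>Loop invariant: the accumulator holds the value of the recursion at the
        counter.\<close>
      from t(2) have "agree m t s \<and> reval (Pr f g) (t m # map s us) (t (m + 1))"
      proof (induction rule: rtrancl_induct)
        case base
        then show ?case using S by (auto simp: agree_def reval_Pr_0_iff)
      next
        case (step t w)
        from step.hyps(2) obtain v where v: "(t, v) \<in> psem \<gamma>"
          "w = v(m + 1 := v (m + 2), m := Suc (v m))" unfolding \<beta> by blast
        note S = implements_sound[OF J v(1)]
        have "v m = t m" "agree m v t" using S(2) by (auto simp: agree_def)
        moreover have "reval g (t m # t (m + 1) # map s us) (v (m + 2))"
          using S(1) unfolding list.map map[OF conjunct1[OF step.IH]] .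
        ultimately show ?case using step.IH v(2)
          by (auto simp: agree_def reval_Pr_Suc_iff)
      qed
      moreover from this have "t u = s u" using us(2) by (auto simp: agree_def)
      ultimately show "reval (Pr f g) (map s rs) (s' r)" "agree m s' (s(r := s' r))"
        using t(3,4) Cons by (auto simp: agree_def)
    next
      fix s y assume "reval (Pr f g) (map s rs) y"
      then have y: "reval (Pr f g) (s u # map s us) y" by (simp add: Cons)
      have "\<exists>p t. (s, p) \<in> psem \<phi> \<and> (p(m := 0), t) \<in> (psem \<beta>)\<^sup>* \<and> agree m t s \<and> t m = j \<and> t (m + 1) = y"
        if "reval (Pr f g) (j # map s us) y" for j y
        using that
      proof (induction j arbitrary: y)
        case 0
        then have "reval f (map s us) y" by (simp add: reval_Pr_0_iff)
        from implements_complete[of _ "reval f", OF I this] obtain p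
          where "(s, p) \<in> psem \<phi>" "agree (m + 3) p (s(m + 1 := y))" .
        then show ?case
          by (intro exI[of _ p] exI[of _ "p(m := 0)"] conjI) (auto simp: agree_def)
      next
        case (Suc j)
        then obtain x where x: "reval (Pr f g) (j # map s us) x" "reval g (j # x # map s us) y"
          by (auto simp: reval_Pr_Suc_iff)
        from Suc.IH[OF x(1)] obtain p t where t: "(s, p) \<in> psem \<phi>" "(p(m := 0), t) \<in> (psem \<beta>)\<^sup>*"
          "agree m t s" "t m = j" "t (m + 1) = x" by blast
        from x(2) have "reval g (map t (m # (m + 1) # us)) y" unfolding list.map map[OF t(3)] t(4,5) .
        from implements_complete[of _ "reval g", OF J this] obtain v
          where v: "(t, v) \<in> psem \<gamma>" "agree (m + 3) v (t(m + 2 := y))" .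
        define w where "w = v(m + 1 := v (m + 2), m := Suc (v m))"
        have "(t, w) \<in> psem \<beta>"
          unfolding \<beta> w_def using v(1) by blast
        with t(2) have "(p(m := 0), w) \<in> (psem \<beta>)\<^sup>*" by (rule rtrancl_into_rtrancl)
        moreover have "v (m + 2) = y" "v m = t m" "agree m v t" using v(2) by (auto simp: agree_def)
        then have "agree m w s" "w m = Suc j" "w (m + 1) = y"
          using t(3,4) by (auto simp: w_def agree_def)
        ultimately show ?case using t(1) by blast
      qed
      from this[OF y] obtain p t where t: "(s, p) \<in> psem \<phi>" "(p(m := 0), t) \<in> (psem \<beta>)\<^sup>*"
          "agree m t s" "t m = s u" "t (m + 1) = y" by blast
      have "t m = t u" using t us(2) by (auto simp: agree_def)
      then have "(s, t(r := t (m + 1))) \<in> psem (rcomp (Pr f g) rs r m)"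
        unfolding P using t r(2) by (auto simp: relcomp_unfold psem_copy)
      moreover have "agree m (t(r := t (m + 1))) (s(r := y))"
        using t by (auto simp: agree_def)
      ultimately show "\<exists>s'. (s, s') \<in> psem (rcomp (Pr f g) rs r m) \<and> agree m s' (s(r := y))" by blast
    qed
  qed
qed

theorem correct: "correct f"
  by (induction f) (auto intro: correct_basic correct_Cn correct_Pr correct_Mn)

section \<open>Automata of programs\<close>

type_synonym edge = "nat \<times> act \<times> nat"

primrec labels :: "prog \<Rightarrow> nat" where
  "labels (Act a) = 0"
| "labels (\<alpha> ;; \<beta>) = Suc (labels \<alpha> + labels \<beta>)"
| "labels (Star \<alpha>) = Suc (labels \<alpha>)"

text \<open>The automaton of a program with entry \<open>p\<close> and exit \<open>q\<close>; its inner control locations are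
  \<open>n, \<dots>, n + labels \<alpha> - 1\<close>.\<close>

primrec edges :: "prog \<Rightarrow> nat \<Rightarrow> nat \<Rightarrow> nat \<Rightarrow> edge list" where
  "edges (Act a) p q n = [(p, a, q)]"
| "edges (\<alpha> ;; \<beta>) p q n = edges \<alpha> p n (Suc n) @ edges \<beta> n q (Suc n + labels \<alpha>)"
| "edges (Star \<alpha>) p q n = (p, Eq 0 0, n) # (n, Eq 0 0, q) # edges \<alpha> n n (Suc n)"

definition estep :: "edge list \<Rightarrow> ((nat \<times> store) \<times> (nat \<times> store)) set" where
  "estep E = {((p, s), (q, s')). \<exists>a. (p, a, q) \<in> set E \<and> step a s s'}"

lemma estep_mono: "set E \<subseteq> set F \<Longrightarrow> (estep E)\<^sup>* \<subseteq> (estep F)\<^sup>*"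
  by (rule rtrancl_mono) (auto simp: estep_def)

lemma edges_complete: "(s, s') \<in> psem \<alpha> \<Longrightarrow> ((p, s), (q, s')) \<in> (estep (edges \<alpha> p q n))\<^sup>*"
proof (induction \<alpha> arbitrary: s s' p q n)
  case (Act a)
  then show ?case by (auto simp: estep_def intro!: r_into_rtrancl)
next
  case (Seq \<alpha> \<beta>)
  then obtain t where t: "(s, t) \<in> psem \<alpha>" "(t, s') \<in> psem \<beta>" by auto
  let ?E = "edges (\<alpha> ;; \<beta>) p q n"
  have "((p, s), (n, t)) \<in> (estep ?E)\<^sup>*"
    using Seq.IH(1)[OF t(1), of p n "Suc n"] estep_mono[of "edges \<alpha> p n (Suc n)" ?E] by auto
  moreover have "((n, t), (q, s')) \<in> (estep ?E)\<^sup>*"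
    using Seq.IH(2)[OF t(2), of n q "Suc n + labels \<alpha>"]
      estep_mono[of "edges \<beta> n q (Suc n + labels \<alpha>)" ?E] by auto
  ultimately show ?case by (rule rtrancl_trans)
next
  case (Star \<alpha>)
  let ?E = "edges (Star \<alpha>) p q n"
  from Star.prems have "(s, s') \<in> (psem \<alpha>)\<^sup>*" by simp
  \<comment> \<open>Iterations run at the fresh location \<open>n\<close>; the two
    \<open>Eq 0 0\<close> edges only enter and leave it.\<close>
  then have "((n, s), (n, s')) \<in> (estep ?E)\<^sup>*"
  proof (induction rule: rtrancl_induct)
    case (step t u)
    from Star.IH[OF step.hyps(2), of n n "Suc n"] estep_mono[of "edges \<alpha> n n (Suc n)" ?E]
    have "((n, t), (n, u)) \<in> (estep ?E)\<^sup>*" by auto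
    with step.IH show ?case by (rule rtrancl_trans)
  qed simp
  moreover have "((p, s), (n, s)) \<in> estep ?E" "((n, s'), (q, s')) \<in> estep ?E"
    by (auto simp: estep_def)
  ultimately show ?case by (meson converse_rtrancl_into_rtrancl rtrancl_into_rtrancl)
qed

lemma edges_labels:
  "(l, a, l') \<in> set (edges \<alpha> p q n) \<Longrightarrow>
    (l = p \<or> l = q \<or> l \<in> {n..<n + labels \<alpha>}) \<and> (l' = p \<or> l' = q \<or> l' \<in> {n..<n + labels \<alpha>})"
  by (induction \<alpha> arbitrary: p q n) fastforce+

text \<open>Soundness by an inductive assertion for every inner control location, rather than by
  decomposing runs.\<close>

lemma edges_invariant:
  assumes "psem \<alpha> `` I p \<subseteq> I q" "p < n" "q < n"
  shows "\<exists>J. (\<forall>l<n. J l = I l) \<and>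
    (\<forall>l a l' s s'. (l, a, l') \<in> set (edges \<alpha> p q n) \<longrightarrow> s \<in> J l \<longrightarrow> step a s s' \<longrightarrow> s' \<in> J l')"
  using assms
proof (induction \<alpha> arbitrary: I p q n)
  case (Act a)
  then show ?case by (intro exI[of _ I]) auto
next
  case (Seq \<alpha> \<beta>)
  let ?n = "Suc n + labels \<alpha>"
  \<comment> \<open>The strongest postcondition of \<open>\<alpha>\<close> is the assertion at the
    middle location \<open>n\<close>; the assertions for \<open>\<beta>\<close> then extend those
    found for \<open>\<alpha>\<close>.\<close>
  from Seq.prems obtain I1 where I1: "\<forall>l<Suc n. I1 l = (I(n := psem \<alpha> `` I p)) l"
    "\<forall>l a l' s s'. (l, a, l') \<in> set (edges \<alpha> p n (Suc n)) \<longrightarrow> s \<in> I1 l \<longrightarrow> step a s s' \<longrightarrow> s' \<in> I1 l'"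
    using Seq.IH(1)[of "I(n := psem \<alpha> `` I p)" p n "Suc n"] by auto
  have "I1 n = psem \<alpha> `` I p" "I1 q = I q" using I1(1) Seq.prems by auto
  then have "psem \<beta> `` I1 n \<subseteq> I1 q" using Seq.prems(1) by (simp add: relcomp_Image)
  then obtain J where J: "\<forall>l<?n. J l = I1 l"
    "\<forall>l a l' s s'. (l, a, l') \<in> set (edges \<beta> n q ?n) \<longrightarrow> s \<in> J l \<longrightarrow> step a s s' \<longrightarrow> s' \<in> J l'"
    using Seq.IH(2)[of I1 n q ?n] Seq.prems by auto
  \<comment> \<open>All locations of \<open>\<alpha>\<close> lie below \<open>?n\<close>, where
    \<open>J\<close> coincides with \<open>I1\<close>.\<close>
  have "s' \<in> J l'" if E: "(l, a, l') \<in> set (edges \<alpha> p n (Suc n))" and s: "s \<in> J l" "step a s s'" for l a l' s s'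
  proof -
    have "l < ?n" "l' < ?n" using edges_labels[OF E] Seq.prems by auto
    then have "J l = I1 l" "J l' = I1 l'" using J(1) by auto
    then show ?thesis using I1(2) E s by blast
  qed
  with J(2) have "\<forall>l a l' s s'. (l, a, l') \<in> set (edges (\<alpha> ;; \<beta>) p q n) \<longrightarrow>
      s \<in> J l \<longrightarrow> step a s s' \<longrightarrow> s' \<in> J l'"
    by (simp only: edges.simps set_append Un_iff) blast
  moreover have "\<forall>l<n. J l = I l" using J(1) I1(1) by auto
  ultimately show ?case by blast
next
  case (Star \<alpha>)
  \<comment> \<open>The stores reachable by any number of iterations form the loop
    assertion.\<close>
  let ?A = "(psem \<alpha>)\<^sup>* `` I p"
  have "psem \<alpha> `` ?A \<subseteq> ?A" by (auto intro: rtrancl_into_rtrancl)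
  then obtain J where J: "\<forall>l<Suc n. J l = (I(n := ?A)) l"
    "\<forall>l a l' s s'. (l, a, l') \<in> set (edges \<alpha> n n (Suc n)) \<longrightarrow> s \<in> J l \<longrightarrow> step a s s' \<longrightarrow> s' \<in> J l'"
    using Star.IH[of "I(n := ?A)" n n "Suc n"] by auto
  have "J n = ?A" "J p = I p" "J q = I q" using J(1) Star.prems by auto
  moreover have "?A \<subseteq> I q" using Star.prems(1) by simp
  moreover have "I p \<subseteq> ?A" by auto
  moreover have "\<forall>l<n. J l = I l" using J(1) by simp
  ultimately show ?case using J(2) by (intro exI[of _ J]) auto
qed

lemma edges_sound:
  assumes "((0, s), (1, s')) \<in> (estep (edges \<alpha> 0 1 2))\<^sup>*"
  shows "(s, s') \<in> psem \<alpha>"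
proof -
  \<comment> \<open>Starting from \<open>{s}\<close> at the entry, the exit assertion is the image
    of \<open>s\<close>, so membership there is the claim.\<close>
  define I where "I l = (if l = 0 then {s} else if l = (1::nat) then psem \<alpha> `` {s} else {})" for l
  obtain J where J: "\<forall>l<2. J l = I l"
    "\<forall>l a l' s s'. (l, a, l') \<in> set (edges \<alpha> 0 1 2) \<longrightarrow> s \<in> J l \<longrightarrow> step a s s' \<longrightarrow> s' \<in> J l'"
    using edges_invariant[of \<alpha> I 0 1 2] by (auto simp: I_def)
  have "s' \<in> J l" if "((0, s), (l, s')) \<in> (estep (edges \<alpha> 0 1 2))\<^sup>*" for l s'
    using that
  proof (induction rule: rtrancl_induct2)
    case refl
    show ?case using J(1) by (simp add: I_def)
  next
    case (step l t l' t')
    then show ?case using J(2) unfolding estep_def by blast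
  qed
  from this[OF assms] show ?thesis using J(1) by (simp add: I_def)
qed

section \<open>Comparing distances\<close>

definition And :: "form \<Rightarrow> form \<Rightarrow> form" where
  "And \<phi> \<psi> = Neg (Or (Neg \<phi>) (Neg \<psi>))"

primrec Ors :: "form list \<Rightarrow> form" where
  "Ors [] = Neg TT"
| "Ors (\<phi> # \<phi>s) = Or \<phi> (Ors \<phi>s)"

primrec Ands :: "form list \<Rightarrow> form" where
  "Ands [] = TT"
| "Ands (\<phi> # \<phi>s) = And \<phi> (Ands \<phi>s)"

text \<open>With \<open>1/2\<close> as the threshold for truth, this says that the value of \<open>\<psi>\<close> is at most that of \<open>\<phi>\<close>.\<close>

definition Geq :: "form \<Rightarrow> form \<Rightarrow> form" where
  "Geq \<phi> \<psi> = Avg \<phi> (Neg \<psi>)"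

text \<open>Name 0 is a fixed choice; the argument works for whichever discounting function it
  denotes.\<close>

definition Dist :: "nat \<Rightarrow> form" where
  "Dist p = DUntil 0 TT (Prop p)"

text \<open>Two-valued, and primitive recursive in \<open>n\<close>, so that its code can be
  computed from \<open>n\<close>.\<close>

primrec Not_first :: "nat \<Rightarrow> nat \<Rightarrow> form" where
  "Not_first p 0 = Neg (Prop p)"
| "Not_first p (Suc n) = Or (Prop p) (Next (Not_first p n))"

text \<open>The outer \<open>Next\<close> steps past the current mark, so that the until finds the
  following one.\<close>

definition Next_conf :: "form \<Rightarrow> form" where
  "Next_conf \<phi> = Next (Until (Neg (Prop 1)) (And (Prop 1) \<phi>))"

definition first :: "computation \<Rightarrow> nat \<Rightarrow> nat \<Rightarrow> bool" where
  "first \<pi> p d \<longleftrightarrow> p \<in> \<pi> d \<and> (\<forall>j<d. p \<notin> \<pi> j)"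

lemma first_unique: "first \<pi> p d \<Longrightarrow> first \<pi> p e \<Longrightarrow> d = e"
  unfolding first_def by (meson linorder_neqE_nat)

lemma first_exists: "p \<in> \<pi> j \<Longrightarrow> \<exists>d. first \<pi> p d"
  unfolding first_def by (rule exists_least_iff[THEN iffD1]) blast

lemma suffix_suffix [simp]: "suffix i (suffix j \<pi>) = suffix (j + i) \<pi>"
  by (simp add: suffix_def add.assoc)

lemma suffix_nth [simp]: "suffix i \<pi> j = \<pi> (i + j)"
  by (simp add: suffix_def)

lemma suffix_0 [simp]: "suffix 0 \<pi> = \<pi>"
  by (simp add: suffix_def)

lemma first_suffix: "first \<pi> p d \<Longrightarrow> i \<le> d \<Longrightarrow> first (suffix i \<pi>) p (d - i)"
  by (auto simp: first_def)

lemma minlt_le_1: "minlt i g \<le> 1"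
  by (simp add: minlt_def)

lemma minlt_le: "j < i \<Longrightarrow> minlt i g \<le> g j"
  by (auto simp: minlt_def)

lemma minlt_ge: "x \<le> 1 \<Longrightarrow> (\<And>j. j < i \<Longrightarrow> x \<le> g j) \<Longrightarrow> x \<le> minlt i g"
  by (auto simp: minlt_def)

lemma SUP_eqI_real:
  fixes f :: "nat \<Rightarrow> real"
  assumes "f i = x" "\<And>j. f j \<le> x"
  shows "(SUP j. f j) = x"
  using assms by (intro cSup_eq_maximum) auto

section \<open>Values of formulas and truth at threshold 1/2\<close>

locale discounted =
  fixes nm :: "nat \<Rightarrow> nat \<Rightarrow> real"
  assumes nm: "discounting (nm e)"
begin

abbreviation "val \<equiv> sem nm"
abbreviation "\<eta> \<equiv> nm 0"

lemma nm_bounds: "0 \<le> nm e i" "nm e i \<le> 1"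
  using nm[of e] by (auto simp: discounting_def)

lemma \<eta>_less_iff: "\<eta> i < \<eta> j \<longleftrightarrow> j < i"
  using nm[of 0] by (metis discounting_def linorder_neqE_nat order_less_asym less_irrefl)

lemma \<eta>_le_iff: "\<eta> i \<le> \<eta> j \<longleftrightarrow> j \<le> i"
  using \<eta>_less_iff[of j i] by linarith

lemma SUP_bounds:
  assumes "\<And>i. 0 \<le> f i \<and> f i \<le> (1::real)"
  shows "0 \<le> (SUP i. f (i::nat)) \<and> (SUP i. f i) \<le> 1"
proof
  have "bdd_above (range f)" using assms by (intro bdd_aboveI2[of _ _ 1]) auto
  then show "0 \<le> (SUP i. f i)" using assms by (intro cSUP_upper2[of f _ 0]) auto
  show "(SUP i. f i) \<le> 1" using assms by (intro cSUP_least) auto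
qed

lemma val_bounds: "0 \<le> val \<pi> \<phi> \<and> val \<pi> \<phi> \<le> 1"
proof (induction \<phi> arbitrary: \<pi>)
  case (Until \<phi> \<psi>)
  show ?case unfolding sem.simps
    using Until by (intro SUP_bounds) (auto intro!: minlt_ge simp: min_le_iff_disj)
next
  case (DUntil e \<phi> \<psi>)
  show ?case unfolding sem.simps
    using DUntil nm_bounds
    by (intro SUP_bounds) (auto intro!: minlt_ge mult_nonneg_nonneg simp: min_le_iff_disj minlt_le_1)
next
  case (Or \<phi> \<psi>)
  then show ?case by (simp add: le_max_iff_disj)
next
  case (Avg \<phi> \<psi>)
  from Avg(1)[of \<pi>] Avg(2)[of \<pi>] show ?case by simp
qed auto

lemma val_ge_0: "0 \<le> val \<pi> \<phi>" and val_le_1: "val \<pi> \<phi> \<le> 1"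
  using val_bounds by auto

lemma val_And: "val \<pi> (And \<phi> \<psi>) = min (val \<pi> \<phi>) (val \<pi> \<psi>)"
  by (simp add: And_def min_def max_def)

lemma val_Eventually: "val \<pi> (Until TT \<phi>) = (SUP i. val (suffix i \<pi>) \<phi>)"
proof -
  have "minlt i (\<lambda>_. 1) = 1" for i
    using minlt_le_1 by (intro antisym minlt_ge) auto
  then show ?thesis using val_le_1 by (simp add: min_absorb1)
qed

lemma val_Dist:
  assumes "first \<pi> p d"
  shows "val \<pi> (Dist p) = \<eta> d"
proof -
  \<comment> \<open>As \<open>\<eta>\<close> decreases, the minimum over the earlier
    \<open>\<eta> j\<close> is at least \<open>\<eta> i\<close> and never binds.\<close>
  have "min (\<eta> i * (if p \<in> \<pi> i then 1 else 0)) (minlt i \<eta>) = (if p \<in> \<pi> i then \<eta> i else 0)" for i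
    using nm_bounds[of 0] by (auto intro!: minlt_ge min_absorb1 simp: \<eta>_le_iff)
  then have "val \<pi> (Dist p) = (SUP i. if p \<in> \<pi> i then \<eta> i else 0)"
    by (simp add: Dist_def)
  also have "\<dots> = \<eta> d"
  proof (rule SUP_eqI_real[of _ d])
    have "d \<le> i" if "p \<in> \<pi> i" for i
      using that assms by (meson first_def leI)
    then show "(if p \<in> \<pi> i then \<eta> i else 0) \<le> \<eta> d" for i
      using nm_bounds(1)[of 0] by (simp add: \<eta>_le_iff)
  qed (use assms in \<open>simp add: first_def\<close>)
  finally show ?thesis .
qed

lemma val_Dist_none:
  assumes "\<And>i. p \<notin> \<pi> i"
  shows "val \<pi> (Dist p) = 0"
  using assms nm_bounds[of 0] by (auto simp: Dist_def intro!: SUP_eqI_real min_absorb1 minlt_ge)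

text \<open>Only index \<open>d\<close> contributes to the supremum: earlier ones lack the mark, and
  for later ones the minimum contains the value 0 at \<open>d\<close>. So the value of
  \<open>\<phi>\<close>, not only its truth, is carried over.\<close>

lemma val_Next_conf:
  assumes "first (suffix 1 \<pi>) 1 d"
  shows "val \<pi> (Next_conf \<phi>) = val (suffix (Suc d) \<pi>) \<phi>"
proof -
  define c :: "nat \<Rightarrow> real" where "c i = (if 1 \<in> \<pi> (Suc i) then 1 else 0)" for i
  have c: "c d = 1" "\<And>i. i < d \<Longrightarrow> c i = 0" and c01: "c i = 0 \<or> c i = 1" for i
    using assms by (auto simp: first_def c_def)
  have x: "0 \<le> val (suffix (Suc d) \<pi>) \<phi>" "val (suffix (Suc d) \<pi>) \<phi> \<le> 1"
    by (rule val_ge_0 val_le_1)+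
  have "val \<pi> (Next_conf \<phi>) =
      (SUP i. min (min (c i) (val (suffix (Suc i) \<pi>) \<phi>)) (minlt i (\<lambda>j. 1 - c j)))"
    by (simp add: Next_conf_def val_And c_def)
  also have "\<dots> = val (suffix (Suc d) \<pi>) \<phi>"
  proof (rule SUP_eqI_real[of _ d])
    have "minlt d (\<lambda>j. 1 - c j) \<ge> 1" using c(2) by (intro minlt_ge) auto
    then show "min (min (c d) (val (suffix (Suc d) \<pi>) \<phi>)) (minlt d (\<lambda>j. 1 - c j)) =
        val (suffix (Suc d) \<pi>) \<phi>" using c(1) x by simp
    show "min (min (c i) (val (suffix (Suc i) \<pi>) \<phi>)) (minlt i (\<lambda>j. 1 - c j)) \<le>
        val (suffix (Suc d) \<pi>) \<phi>" for i
      using c c01[of i] x minlt_le[of d i "\<lambda>j. 1 - c j"]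
      by (cases i d rule: linorder_cases) (auto simp: min_le_iff_disj)
  qed
  finally show ?thesis .
qed

text \<open>This truth commutes with \<open>Or\<close> and \<open>And\<close> but not with
  \<open>Neg\<close>, since at value 1/2 a formula and its negation are both flagged. Outside
  \<open>Geq\<close> and \<open>And\<close>, \<open>Neg\<close> is therefore applied only to
  two-valued formulas.\<close>

definition flag :: "form \<Rightarrow> computation \<Rightarrow> bool" where
  "flag \<phi> \<pi> \<longleftrightarrow> 1 / 2 \<le> val \<pi> \<phi>"

lemma flag_Or: "flag (Or \<phi> \<psi>) \<pi> \<longleftrightarrow> flag \<phi> \<pi> \<or> flag \<psi> \<pi>"
  by (simp add: flag_def le_max_iff_disj)

lemma flag_And: "flag (And \<phi> \<psi>) \<pi> \<longleftrightarrow> flag \<phi> \<pi> \<and> flag \<psi> \<pi>"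
  by (simp add: flag_def val_And)

lemma flag_Ors: "flag (Ors \<phi>s) \<pi> \<longleftrightarrow> (\<exists>\<phi>\<in>set \<phi>s. flag \<phi> \<pi>)"
  by (induction \<phi>s) (simp_all add: flag_def le_max_iff_disj)

lemma flag_Ands: "flag (Ands \<phi>s) \<pi> \<longleftrightarrow> (\<forall>\<phi>\<in>set \<phi>s. flag \<phi> \<pi>)"
  by (induction \<phi>s) (simp_all add: flag_def val_And)

text \<open>Since \<open>(x + (1 - y)) / 2 \<ge> 1 / 2\<close> iff \<open>y \<le> x\<close>;
  averaging enters the construction only here.\<close>

lemma flag_Geq: "flag (Geq \<phi> \<psi>) \<pi> \<longleftrightarrow> val \<pi> \<psi> \<le> val \<pi> \<phi>"
  by (auto simp: flag_def Geq_def)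

lemma val_Not_first: "val \<pi> (Not_first p n) = (if first \<pi> p n then 0 else 1)"
proof (induction n arbitrary: \<pi>)
  case 0
  then show ?case by (simp add: first_def)
next
  case (Suc n)
  have "first \<pi> p (Suc n) \<longleftrightarrow> p \<notin> \<pi> 0 \<and> first (suffix 1 \<pi>) p n"
    by (auto simp: first_def less_Suc_eq_0_disj)
  with Suc show ?case by (simp del: suffix_nth)
qed

lemma flag_Not_first: "flag (Not_first p n) \<pi> \<longleftrightarrow> \<not> first \<pi> p n"
  by (simp add: flag_def val_Not_first)

lemma flag_Prop: "flag (Prop p) \<pi> \<longleftrightarrow> p \<in> \<pi> 0"
  by (simp add: flag_def)

lemma flag_Eventually: "flag \<phi> (suffix i \<pi>) \<Longrightarrow> flag (Until TT \<phi>) \<pi>"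
  unfolding val_Eventually flag_def
  by (rule cSUP_upper2[of _ _ i]) (auto intro!: bdd_aboveI2[of _ _ 1] val_le_1)

text \<open>The supremum of values below \<open>1/2\<close> may be \<open>1/2\<close>, so finiteness of the support is essential.\<close>

lemma not_flag_Eventually:
  assumes "\<And>i. \<not> flag \<phi> (suffix i \<pi>)" "\<And>i. n \<le> i \<Longrightarrow> val (suffix i \<pi>) \<phi> = 0"
  shows "\<not> flag (Until TT \<phi>) \<pi>"
proof -
  let ?V = "range (\<lambda>i. val (suffix i \<pi>) \<phi>)"
  have "?V \<subseteq> insert 0 ((\<lambda>i. val (suffix i \<pi>) \<phi>) ` {..<n})"
    using assms(2) by (auto simp: not_less[symmetric])
  then have fin: "finite ?V" by (rule finite_subset) auto
  then have "Sup ?V = Max ?V" by (intro cSup_eq_Max) auto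
  also have "\<dots> \<in> ?V" using fin by (intro Max_in) auto
  finally show ?thesis using assms(1) unfolding val_Eventually flag_def by auto
qed

end

text \<open>A wrong successor value must give a value of at least \<open>1/2\<close> and the right one a value strictly
  below. So \<open>x' \<noteq> x\<close> is expressed as \<open>x' \<le> x - 1 \<or> x \<le> x' - 1\<close>, where \<open>Next\<close> subtracts \<open>1\<close> from a
  positive distance.\<close>

definition err_same :: "nat \<Rightarrow> form" where
  "err_same p = Or (Geq (Next_conf (Dist p)) (Next (Dist p))) (Geq (Dist p) (Next_conf (Next (Dist p))))"

text \<open>Now \<open>x' \<noteq> x + 1\<close> becomes \<open>x' \<le> x\<close> or
  \<open>x \<le> x' - 2\<close>.\<close>

definition err_inc :: "nat \<Rightarrow> form" where
  "err_inc p = Or (Geq (Next_conf (Dist p)) (Dist p)) (Geq (Dist p) (Next_conf (Next (Next (Dist p)))))"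

definition err_eq :: "nat \<Rightarrow> nat \<Rightarrow> form" where
  "err_eq p q = Or (Geq (Dist p) (Next (Dist q))) (Geq (Dist q) (Next (Dist p)))"

text \<open>A register set to 0 must be marked at distance 1, which \<open>Not_first\<close> tests
  without any comparison. All registers that the action leaves alone get
  \<open>err_same\<close>.\<close>

fun act_err :: "nat \<Rightarrow> act \<Rightarrow> form list" where
  "act_err k (Zero r) =
     Next_conf (Not_first (r + 2) 1) # map (\<lambda>i. err_same (i + 2)) (filter ((\<noteq>) r) [0..<k])"
| "act_err k (Inc r) = err_inc (r + 2) # map (\<lambda>i. err_same (i + 2)) (filter ((\<noteq>) r) [0..<k])"
| "act_err k (Eq u v) = err_eq (u + 2) (v + 2) # map (\<lambda>i. err_same (i + 2)) [0..<k]"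

text \<open>Meant to be flagged when this edge does not explain the passage to the next
  configuration; a configuration is in error only if all edges fail.\<close>

fun edge_err :: "nat \<Rightarrow> edge \<Rightarrow> form" where
  "edge_err k (p, a, q) =
     Ors (Not_first 0 p # Next_conf (Not_first 0 q) # act_err k a)"

fun regs :: "act \<Rightarrow> nat set" where
  "regs (Zero r) = {r}"
| "regs (Inc r) = {r}"
| "regs (Eq u v) = {u, v}"

text \<open>Proposition \<open>1\<close> marks the start of a configuration. From there the first occurrence of
  proposition \<open>0\<close> is at the distance given by the control location, and the first occurrence of
  proposition \<open>r + 2\<close> is at the distance given by the successor of register \<open>r\<close>. The marks may lie
  beyond the start of the next configuration.\<close>

definition conf :: "nat \<Rightarrow> computation \<Rightarrow> nat \<Rightarrow> store \<Rightarrow> bool" where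
  "conf k \<pi> p s \<longleftrightarrow> 1 \<in> \<pi> 0 \<and> first \<pi> 0 p \<and> (\<forall>r<k. first \<pi> (r + 2) (Suc (s r)))"

section \<open>The error formulas detect exactly the wrong successors\<close>

context discounted
begin

context
  fixes \<pi> d
  assumes nxt: "first (suffix 1 \<pi>) 1 d"
begin

abbreviation "\<pi>' \<equiv> suffix (Suc d) \<pi>"

lemma flag_err_same:
  assumes "first \<pi> p (Suc n)"
  shows "flag (err_same p) \<pi> \<longleftrightarrow> \<not> first \<pi>' p (Suc n)"
proof (cases "\<exists>m. first \<pi>' p m")
  case False
  \<comment> \<open>Without a mark the shifted distance has value 0, at most
    \<open>\<eta> (Suc n)\<close>, so the second comparison flags the error.\<close>
  then have "p \<notin> \<pi>' j" for j using first_exists by blast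
  then have "p \<notin> \<pi> j" if "d < j" for j
    using that by (metis Suc_leI le_add_diff_inverse suffix_nth)
  then have "val \<pi>' (Next (Dist p)) = 0"
    by (auto intro!: val_Dist_none)
  then show ?thesis
    using False nm_bounds(1)[of 0]
    by (auto simp: err_same_def flag_Or flag_Geq val_Next_conf[OF nxt] val_Dist[OF assms] simp del: sem.simps)
next
  case True
  then obtain m where m: "first \<pi>' p m" by blast
  have n: "val \<pi> (Next (Dist p)) = \<eta> n"
    using val_Dist[OF first_suffix[OF assms, of 1]] by simp
  have "flag (err_same p) \<pi> \<longleftrightarrow> m \<le> n \<or> \<eta> (Suc n) \<ge> val \<pi>' (Next (Dist p))"
    by (simp add: err_same_def flag_Or flag_Geq val_Next_conf[OF nxt] val_Dist[OF assms]
        val_Dist[OF m] n \<eta>_le_iff del: sem.simps)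
  also have "\<dots> \<longleftrightarrow> m \<noteq> Suc n"
  \<comment> \<open>\<open>Next\<close> reduces the distance only if \<open>m\<close> is positive;
    for \<open>m = 0\<close> the comparison \<open>m \<le> n\<close> already holds.\<close>
  proof (cases "m = 0")
    case False
    then have "val \<pi>' (Next (Dist p)) = \<eta> (m - 1)"
      using val_Dist[OF first_suffix[OF m, of 1]] by simp
    with False show ?thesis by (auto simp: \<eta>_le_iff)
  qed simp
  also have "\<dots> \<longleftrightarrow> \<not> first \<pi>' p (Suc n)" using m first_unique by blast
  finally show ?thesis .
qed

lemma flag_err_inc:
  assumes "first \<pi> p (Suc n)"
  shows "flag (err_inc p) \<pi> \<longleftrightarrow> \<not> first \<pi>' p (Suc (Suc n))"
proof (cases "\<exists>m. first \<pi>' p m")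
  case False
  then have "p \<notin> \<pi>' j" for j using first_exists by blast
  then have "p \<notin> \<pi> j" if "d < j" for j
    using that by (metis Suc_leI le_add_diff_inverse suffix_nth)
  then have "val \<pi>' (Next (Next (Dist p))) = 0"
    by (auto intro!: val_Dist_none)
  then show ?thesis
    using False nm_bounds(1)[of 0]
    by (auto simp: err_inc_def flag_Or flag_Geq val_Next_conf[OF nxt] val_Dist[OF assms] simp del: sem.simps)
next
  case True
  then obtain m where m: "first \<pi>' p m" by blast
  have "flag (err_inc p) \<pi> \<longleftrightarrow> m \<le> Suc n \<or> \<eta> (Suc n) \<ge> val \<pi>' (Next (Next (Dist p)))"
    by (simp add: err_inc_def flag_Or flag_Geq val_Next_conf[OF nxt] val_Dist[OF assms]
        val_Dist[OF m] \<eta>_le_iff del: sem.simps)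
  also have "\<dots> \<longleftrightarrow> m \<noteq> Suc (Suc n)"
  \<comment> \<open>Skipping two positions needs \<open>m \<ge> 2\<close>, which holds whenever the
    first disjunct fails.\<close>
  proof (cases "m \<le> Suc n")
    case False
    then have "val \<pi>' (Next (Next (Dist p))) = \<eta> (m - 2)"
      using val_Dist[OF first_suffix[OF m, of 2]] by (simp add: numeral_2_eq_2)
    with False show ?thesis by (auto simp: \<eta>_le_iff)
  qed simp
  also have "\<dots> \<longleftrightarrow> \<not> first \<pi>' p (Suc (Suc n))" using m first_unique by blast
  finally show ?thesis .
qed

lemma flag_Next_conf_Not_first: "flag (Next_conf (Not_first p n)) \<pi> \<longleftrightarrow> \<not> first \<pi>' p n"
  by (simp add: flag_def val_Next_conf[OF nxt] val_Not_first)

text \<open>\<open>Next\<close> on one side turns each weak comparison of distances into a strict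
  one.\<close>

lemma flag_err_eq:
  assumes "first \<pi> p (Suc m)" "first \<pi> q (Suc n)"
  shows "flag (err_eq p q) \<pi> \<longleftrightarrow> m \<noteq> n"
proof -
  have "val \<pi> (Next (Dist p)) = \<eta> m" "val \<pi> (Next (Dist q)) = \<eta> n"
    using val_Dist[OF first_suffix[OF assms(1), of 1]] val_Dist[OF first_suffix[OF assms(2), of 1]]
    by simp_all
  then show ?thesis
    by (auto simp: err_eq_def flag_Or flag_Geq val_Dist[OF assms(1)] val_Dist[OF assms(2)]
        \<eta>_le_iff simp del: sem.simps)
qed

text \<open>An action determines the next store or blocks, so the location, the changed register or
  the test, and each remaining register can be checked separately.\<close>

lemma flag_edge_err:
  assumes "conf k \<pi> p s" "regs a \<subseteq> {..<k}"
  shows "flag (edge_err k (p', a, q)) \<pi> \<longleftrightarrow> \<not> (p' = p \<and> (\<exists>s'. step a s s' \<and> conf k \<pi>' q s'))"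
proof -
  have r: "first \<pi> (r + 2) (Suc (s r))" if "r < k" for r
    using assms(1) that by (simp add: conf_def)
  have p: "first \<pi> 0 p' \<longleftrightarrow> p' = p"
    using assms(1) first_unique unfolding conf_def by blast
  have 1: "1 \<in> \<pi>' 0" using nxt by (simp add: first_def)
  have same: "(\<exists>\<phi>\<in>set (map (\<lambda>i. err_same (i + 2)) xs). flag \<phi> \<pi>) \<longleftrightarrow>
      (\<exists>i\<in>set xs. \<not> first \<pi>' (i + 2) (Suc (s i)))" if "set xs \<subseteq> {..<k}" for xs
    using that flag_err_same[OF r] by fastforce
  have "(\<exists>\<phi>\<in>set (act_err k a). flag \<phi> \<pi>) \<longleftrightarrow>
      \<not> (\<exists>s'. step a s s' \<and> (\<forall>r<k. first \<pi>' (r + 2) (Suc (s' r))))"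
  proof (cases a)
    case (Zero x)
    have "(\<exists>\<phi>\<in>set (act_err k a). flag \<phi> \<pi>) \<longleftrightarrow>
        \<not> first \<pi>' (x + 2) 1 \<or> (\<exists>i\<in>set (filter ((\<noteq>) x) [0..<k]). \<not> first \<pi>' (i + 2) (Suc (s i)))"
      by (subst same[symmetric]) (auto simp: Zero flag_Next_conf_Not_first simp del: Not_first.simps)
    with Zero assms(2) show ?thesis by auto
  next
    case (Inc x)
    have "(\<exists>\<phi>\<in>set (act_err k a). flag \<phi> \<pi>) \<longleftrightarrow> \<not> first \<pi>' (x + 2) (Suc (Suc (s x))) \<or>
        (\<exists>i\<in>set (filter ((\<noteq>) x) [0..<k]). \<not> first \<pi>' (i + 2) (Suc (s i)))"
      using flag_err_inc[OF r[of x]] assms(2)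
      by (subst same[symmetric]) (auto simp: Inc simp del: Not_first.simps)
    with Inc assms(2) show ?thesis by auto
  next
    case (Eq u v)
    have "(\<exists>\<phi>\<in>set (act_err k a). flag \<phi> \<pi>) \<longleftrightarrow> s u \<noteq> s v \<or>
        (\<exists>i\<in>set [0..<k]. \<not> first \<pi>' (i + 2) (Suc (s i)))"
      using flag_err_eq[OF r[of u] r[of v]] assms(2)
      by (subst same[symmetric]) (auto simp: Eq simp del: Not_first.simps)
    with Eq assms(2) show ?thesis by auto
  qed
  then show ?thesis
    using p flag_Next_conf_Not_first[of 0 q] 1
    by (simp add: flag_Or flag_Ors flag_Not_first conf_def del: sem.simps)
qed

end

end

section \<open>The formula of a program\<close>

text \<open>The disjuncts list the ways to miss a halting run: a wrong start, a configuration away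
  from the exit location 1 that no edge continues, or no arrival at location 1. The inputs are left
  to \<open>input_form\<close>, so this formula has a code before they are chosen.\<close>

definition main_form :: "edge list \<Rightarrow> nat \<Rightarrow> form" where
  "main_form E k = Ors ([Neg (Prop 1), Not_first 0 0] @ map (\<lambda>r. Not_first (r + 2) 1) [2..<k] @
     [Until TT (And (Prop 1) (And (Not_first 0 1) (Ands (map (edge_err k) E)))),
      Neg (Until TT (And (Prop 1) (Neg (Not_first 0 1))))])"

definition input_form :: "nat \<Rightarrow> nat \<Rightarrow> form \<Rightarrow> form" where
  "input_form a b \<phi> = Or (Not_first 2 (Suc a)) (Or (Not_first 3 (Suc b)) \<phi>)"

definition input_store :: "nat \<Rightarrow> nat \<Rightarrow> store" where
  "input_store a b = (\<lambda>_. 0)(0 := a, 1 := b)"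

definition bounded_regs :: "nat \<Rightarrow> edge list \<Rightarrow> bool" where
  "bounded_regs k E \<longleftrightarrow> 2 \<le> k \<and> (\<forall>(p, a, q)\<in>set E. regs a \<subseteq> {..<k})"

lemma bounded_regs_exists: "\<exists>k. bounded_regs k E"
proof -
  have fin: "finite (regs a)" for a by (cases a) auto
  have "finite (\<Union>(p, a, q)\<in>set E. regs a)" by (auto simp: fin)
  then obtain k where "\<forall>r\<in>(\<Union>(p, a, q)\<in>set E. regs a). r < k"
    unfolding finite_nat_set_iff_bounded by blast
  then show ?thesis by (intro exI[of _ "k + 2"]) (fastforce simp: bounded_regs_def)
qed

context discounted
begin

text \<open>The body is two-valued, so the supremum is 0 or 1 and \<open>Neg\<close> complements
  truth here.\<close>

lemma flag_Eventually_halt: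
  "flag (Neg (Until TT (And (Prop 1) (Neg (Not_first 0 1))))) \<pi> \<longleftrightarrow>
    \<not> (\<exists>t. 1 \<in> \<pi> t \<and> first (suffix t \<pi>) 0 1)"
proof -
  let ?v = "\<lambda>t. val (suffix t \<pi>) (And (Prop 1) (Neg (Not_first 0 1)))"
  have v: "?v t = (if 1 \<in> \<pi> t \<and> first (suffix t \<pi>) 0 1 then 1 else 0)" for t
    by (simp add: val_And val_Not_first del: Not_first.simps)
  show ?thesis
  proof (cases "\<exists>t. 1 \<in> \<pi> t \<and> first (suffix t \<pi>) 0 1")
    case True
    then obtain t where "?v t = 1" using v by auto
    then have "(SUP t. ?v t) = 1" by (rule SUP_eqI_real) (rule val_le_1)
    then have "val \<pi> (Until TT (And (Prop 1) (Neg (Not_first 0 1)))) = 1" unfolding val_Eventually .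
    then show ?thesis using True by (simp add: flag_def del: sem.simps(6))
  next
    case False
    then have v0: "?v t = 0" for t using v[of t] by auto
    have "(SUP t. ?v t) = 0" unfolding v0 by simp
    then have "val \<pi> (Until TT (And (Prop 1) (Neg (Not_first 0 1)))) = 0" unfolding val_Eventually .
    then show ?thesis using False by (simp add: flag_def del: sem.simps(6))
  qed
qed

lemma flag_input_form:
  assumes k: "2 \<le> k"
  shows "flag (input_form a b (main_form E k)) \<pi> \<longleftrightarrow>
    \<not> (conf k \<pi> 0 (input_store a b) \<and>
      (\<exists>t. 1 \<in> \<pi> t \<and> first (suffix t \<pi>) 0 1) \<and>
      \<not> flag (Until TT (And (Prop 1) (And (Not_first 0 1) (Ands (map (edge_err k) E))))) \<pi>)"
proof -
  have "(\<forall>r<k. P r (input_store a b r)) \<longleftrightarrow> P 0 a \<and> P 1 b \<and> (\<forall>r\<in>{2..<k}. P r 0)" for P :: "nat \<Rightarrow> nat \<Rightarrow> bool"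
  proof -
    have "{..<k} = {0, 1} \<union> {2..<k}" using k by auto
    then have "(\<forall>r<k. Q r) \<longleftrightarrow> Q 0 \<and> Q 1 \<and> (\<forall>r\<in>{2..<k}. Q r)" for Q
      by (metis (no_types, lifting) Un_iff empty_iff insert_iff lessThan_iff)
    then show ?thesis by (simp add: input_store_def)
  qed
  from this[of "\<lambda>r x. first \<pi> (r + 2) (Suc x)"]
  have regs: "(\<forall>r<k. first \<pi> (r + 2) (Suc (input_store a b r))) \<longleftrightarrow>
      first \<pi> 2 (Suc a) \<and> first \<pi> 3 (Suc b) \<and> (\<forall>r\<in>{2..<k}. first \<pi> (r + 2) 1)"
    by (simp add: numeral_2_eq_2 numeral_3_eq_3)
  have "flag (Neg (Prop 1)) \<pi> \<longleftrightarrow> 1 \<notin> \<pi> 0" by (simp add: flag_def)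
  then show ?thesis
    unfolding input_form_def main_form_def conf_def regs
    by (auto simp: flag_Or flag_Ors flag_Eventually_halt flag_Not_first
        simp del: Not_first.simps sem.simps One_nat_def add_2_eq_Suc')
qed

text \<open>Induction over the marked positions up to the first halting one: an earlier mark is not
  at location 1, so the absence of errors supplies an edge to the next mark.\<close>

lemma input_form_sound:
  assumes E: "bounded_regs k E" and flag: "\<not> flag (input_form a b (main_form E k)) \<pi>"
  shows "\<exists>s'. ((0, input_store a b), (1, s')) \<in> (estep E)\<^sup>*"
proof -
  from E have k: "2 \<le> k" by (simp add: bounded_regs_def)
  let ?err = "And (Prop 1) (And (Not_first 0 1) (Ands (map (edge_err k) E)))"
  from flag have init: "conf k \<pi> 0 (input_store a b)"
    and halt: "\<exists>t. 1 \<in> \<pi> t \<and> first (suffix t \<pi>) 0 1"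
    and no_err: "\<not> flag ?err (suffix t \<pi>)" for t
    unfolding flag_input_form[OF k] by (blast intro: flag_Eventually)+
  obtain T where T: "1 \<in> \<pi> T" "first (suffix T \<pi>) 0 1"
    and min: "\<And>t. t < T \<Longrightarrow> 1 \<in> \<pi> t \<Longrightarrow> \<not> first (suffix t \<pi>) 0 1"
    using halt exists_least_iff[of "\<lambda>t. 1 \<in> \<pi> t \<and> first (suffix t \<pi>) 0 1"] by blast
  have "\<exists>p s. conf k (suffix t \<pi>) p s \<and> ((0, input_store a b), (p, s)) \<in> (estep E)\<^sup>*"
    if "t \<le> T" "1 \<in> \<pi> t" for t
    using that
  proof (induction t rule: less_induct)
    case (less t)
    show ?case
    proof (cases "t = 0")
      case True
      with init show ?thesis by auto
    next
      case False
      \<comment> \<open>\<open>u\<close> is the mark just before \<open>t\<close>, so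
        \<open>Next_conf\<close> at \<open>u\<close> looks at \<open>t\<close>; the distance
        \<open>d\<close> below counts from \<open>Suc u\<close> because of its outer
        \<open>Next\<close>.\<close>
      define u where "u = Max {j. j < t \<and> 1 \<in> \<pi> j}"
      have fin: "finite {j. j < t \<and> 1 \<in> \<pi> j}" by simp
      have "0 \<in> {j. j < t \<and> 1 \<in> \<pi> j}" using False init by (simp add: conf_def)
      then have "u \<in> {j. j < t \<and> 1 \<in> \<pi> j}" unfolding u_def using fin by (intro Max_in) auto
      then have u: "u < t" "1 \<in> \<pi> u" by auto
      have max: "1 \<notin> \<pi> j" if "u < j" "j < t" for j
        using that Max_ge[OF fin, of j] unfolding u_def[symmetric] by auto
      define d where "d = t - Suc u"
      have t: "Suc (u + d) = t" using u by (simp add: d_def)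
      then have nxt: "first (suffix 1 (suffix u \<pi>)) 1 d"
        using less.prems(2) max unfolding first_def by auto
      have "u \<le> T" using u(1) less.prems(1) by simp
      from less.IH[OF u(1) this u(2)] obtain p s where ps: "conf k (suffix u \<pi>) p s"
        "((0, input_store a b), (p, s)) \<in> (estep E)\<^sup>*" by blast
      have "flag (Prop 1) (suffix u \<pi>)" "flag (Not_first 0 1) (suffix u \<pi>)"
        using u min[of u] less.prems(1) by (auto simp: flag_Not_first flag_Prop simp del: Not_first.simps)
      with no_err[of u] obtain e where e: "e \<in> set E" "\<not> flag (edge_err k e) (suffix u \<pi>)"
        by (auto simp: flag_And flag_Ands)
      obtain p' a' q where e': "e = (p', a', q)" by (cases e)
      have "regs a' \<subseteq> {..<k}" using E e(1) unfolding e' bounded_regs_def by auto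
      from e(2)[unfolded e' flag_edge_err[OF nxt ps(1) this]] obtain s'
        where "p' = p" "step a' s s'" "conf k (suffix t \<pi>) q s'" using t by auto
      moreover from this have "((p, s), (q, s')) \<in> estep E" using e(1) e' by (auto simp: estep_def)
      ultimately show ?thesis using ps(2) by (meson rtrancl_into_rtrancl)
    qed
  qed
  from this[OF order_refl T(1)] obtain p s where "conf k (suffix T \<pi>) p s"
    "((0, input_store a b), (p, s)) \<in> (estep E)\<^sup>*" by blast
  moreover from this(1) T(2) have "p = 1" using first_unique unfolding conf_def by blast
  ultimately show ?thesis by blast
qed

text \<open>The run is written in \<open>n + 1\<close> blocks of equal length \<open>B\<close>,
  followed by empty letters.\<close>

lemma input_form_complete:
  assumes E: "bounded_regs k E" and run: "((0, input_store a b), (1, s')) \<in> (estep E)\<^sup>*"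
  shows "\<exists>\<pi>. (\<forall>i. \<pi> i \<subseteq> {..<k + 2}) \<and> \<not> flag (input_form a b (main_form E k)) \<pi>"
proof -
  from E have k: "2 \<le> k" by (simp add: bounded_regs_def)
  from run obtain n where "((0, input_store a b), (1, s')) \<in> estep E ^^ n"
    using rtrancl_imp_relpow by blast
  then obtain f where f: "f 0 = (0, input_store a b)" "f n = (1, s')"
    "\<And>i. i < n \<Longrightarrow> (f i, f (Suc i)) \<in> estep E"
    unfolding relpow_fun_conv by blast
  define p s where "p i = fst (f i)" and "s i = snd (f i)" for i
  \<comment> \<open>\<open>B\<close> exceeds every distance to be marked, so each configuration fits
    into its own block.\<close>
  obtain B where B: "\<And>i. i \<le> n \<Longrightarrow> p i < B" "\<And>i r. i \<le> n \<Longrightarrow> r < k \<Longrightarrow> Suc (s i r) < B"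
  proof -
    have "finite (p ` {..n} \<union> (\<lambda>(i, r). Suc (s i r)) ` ({..n} \<times> {..<k}))" by auto
    then obtain B where "\<forall>x\<in>p ` {..n} \<union> (\<lambda>(i, r). Suc (s i r)) ` ({..n} \<times> {..<k}). x < B"
      unfolding finite_nat_set_iff_bounded by blast
    then show thesis by (intro that[of B]) auto
  qed
  have B0: "0 < B" using B(1)[of 0] by simp
  define \<pi> :: computation where "\<pi> t = (if t div B \<le> n then
      {x. x = 0 \<and> t mod B = p (t div B) \<or> x = 1 \<and> t mod B = 0 \<or>
          (\<exists>r<k. x = r + 2 \<and> t mod B = Suc (s (t div B) r))} else {})" for t
  have \<pi>: "\<pi> (i * B + j) = {x. x = 0 \<and> j = p i \<or> x = 1 \<and> j = 0 \<or> (\<exists>r<k. x = r + 2 \<and> j = Suc (s i r))}"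
    if "i \<le> n" "j < B" for i j
    using that by (simp add: \<pi>_def)
  have \<pi>_iff: "0 \<in> \<pi> (i * B + j) \<longleftrightarrow> j = p i" "1 \<in> \<pi> (i * B + j) \<longleftrightarrow> j = 0"
    "r < k \<Longrightarrow> r + 2 \<in> \<pi> (i * B + j) \<longleftrightarrow> j = Suc (s i r)" if "i \<le> n" "j < B" for i j r
    using that by (auto simp: \<pi>)
  have conf: "conf k (suffix (i * B) \<pi>) (p i) (s i)" if i: "i \<le> n" for i
  proof -
    have "first (suffix (i * B) \<pi>) 0 (p i)"
      unfolding first_def suffix_nth using \<pi>_iff(1)[OF i] B(1)[OF i] by simp
    moreover have "first (suffix (i * B) \<pi>) (r + 2) (Suc (s i r))" if "r < k" for r
      unfolding first_def suffix_nth
      using \<pi>_iff(3)[OF i _ that] B(2)[OF i that] by (simp del: add_Suc_right add_2_eq_Suc')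
    moreover have "1 \<in> suffix (i * B) \<pi> 0"
      unfolding suffix_nth using \<pi>_iff(2)[OF i B0] by simp
    ultimately show ?thesis by (simp add: conf_def del: suffix_nth add_2_eq_Suc')
  qed
  have halt: "first (suffix (n * B) \<pi>) 0 1"
    using conf[OF order_refl] f(2) unfolding conf_def p_def by simp
  have start: "i * B = t \<and> i \<le> n" if "1 \<in> \<pi> t" "i = t div B" for i t
    using that by (auto simp: \<pi>_def split: if_splits)
  have nxt: "first (suffix 1 (suffix (i * B) \<pi>)) 1 (B - 1)" if i: "i < n" for i
  proof -
    have "1 \<in> \<pi> (Suc i * B + 0)" using \<pi>_iff(2)[of "Suc i" 0] i B0 by simp
    moreover have "i * B + 1 + (B - 1) = Suc i * B + 0" using B0 by simp
    moreover have "1 \<notin> \<pi> (i * B + 1 + j)" if "j < B - 1" for j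
      using \<pi>_iff(2)[of i "1 + j"] i that by simp
    ultimately show ?thesis unfolding first_def suffix_suffix suffix_nth by metis
  qed
  \<comment> \<open>The empty tail has value 0 and gives finite support. Block \<open>n\<close> is
    at location 1 and so passes the error test; each earlier block is continued by an edge of the
    run.\<close>
  have "\<not> flag (Until TT (And (Prop 1) (And (Not_first 0 1) (Ands (map (edge_err k) E))))) \<pi>"
  proof (rule not_flag_Eventually[where n = "Suc n * B"])
    show "val (suffix t \<pi>) (And (Prop 1) (And (Not_first 0 1) (Ands (map (edge_err k) E)))) = 0"
      if "Suc n * B \<le> t" for t
    proof -
      have "\<not> t div B \<le> n" using div_le_mono[OF that, of B] B0 by simp
      then have "1 \<notin> \<pi> t" by (simp add: \<pi>_def)
      then show ?thesis using val_ge_0 by (simp add: val_And)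
    qed
    show "\<not> flag (And (Prop 1) (And (Not_first 0 1) (Ands (map (edge_err k) E)))) (suffix t \<pi>)" for t
    proof
      assume "flag (And (Prop 1) (And (Not_first 0 1) (Ands (map (edge_err k) E)))) (suffix t \<pi>)"
      then have fl: "1 \<in> \<pi> t" "\<not> first (suffix t \<pi>) 0 1" "\<forall>e\<in>set E. flag (edge_err k e) (suffix t \<pi>)"
        unfolding flag_And flag_Ands flag_Not_first flag_Prop by simp_all
      from start[OF fl(1) refl] obtain i where i: "t = i * B" "i \<le> n" by metis
      have "i \<noteq> n" using halt fl(2) i(1) by blast
      with i have "i < n" by simp
      from f(3)[OF this] obtain a where a: "(p i, a, p (Suc i)) \<in> set E" "step a (s i) (s (Suc i))"
        by (auto simp: estep_def p_def s_def)
      have "regs a \<subseteq> {..<k}" using E a(1) unfolding bounded_regs_def by auto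
      note fe = flag_edge_err[OF nxt[OF \<open>i < n\<close>] conf[OF i(2)] this, of "p i" "p (Suc i)"]
      have "suffix (Suc (B - 1)) (suffix (i * B) \<pi>) = suffix (Suc i * B) \<pi>"
        using B0 by (simp add: add.commute)
      then have "\<not> flag (edge_err k (p i, a, p (Suc i))) (suffix t \<pi>)"
        using fe a(2) conf[of "Suc i"] \<open>i < n\<close> unfolding i(1) by (metis Suc_leI)
      with fl(3) a(1) show False by blast
    qed
  qed
  moreover have "conf k \<pi> 0 (input_store a b)" using conf[of 0] f(1) by (simp add: p_def s_def)
  moreover have "\<exists>t. 1 \<in> \<pi> t \<and> first (suffix t \<pi>) 0 1"
    using \<pi>_iff(2)[OF order_refl B0] halt by (intro exI[of _ "n * B"]) simp
  ultimately have "\<not> flag (input_form a b (main_form E k)) \<pi>"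
    unfolding flag_input_form[OF k] by blast
  moreover have "\<pi> i \<subseteq> {..<k + 2}" for i by (auto simp: \<pi>_def)
  ultimately show ?thesis by blast
qed

end

section \<open>Computing the instance and diagonalising\<close>

text \<open>A complete graph whose states are all label sets, so the formula alone has to describe
  the runs.\<close>

definition full_kripke :: "nat \<Rightarrow> kripke" where
  "full_kripke N = (let ls = subseqs [0..<N]; n = length ls in
     \<lparr>kn = n, kinit = [0..<n], ktrans = List.product [0..<n] [0..<n], klab = ls\<rparr>)"

lemma wf_full_kripke: "wf_kripke (full_kripke N)"
  by (auto simp: wf_kripke_def full_kripke_def Let_def)

lemma computations_full_kripke: "computations (full_kripke N) = {\<pi>. \<forall>i. \<pi> i \<subseteq> {..<N}}"
proof -
  let ?ls = "subseqs [0..<N]"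
  have Pow: "set ` set ?ls = Pow {..<N}"
    by (simp add: subseqs_powset lessThan_atLeast0)
  have "\<pi> \<in> computations (full_kripke N) \<longleftrightarrow> (\<exists>s. \<forall>i. s i < length ?ls \<and> \<pi> i = set (?ls ! s i))" for \<pi>
    unfolding computations_def full_kripke_def Let_def mem_Collect_eq
    by (intro iff_exI) (auto simp: fun_eq_iff)
  \<comment> \<open>Choice turns a state for each position into a path; every transition is
    allowed.\<close>
  also have "\<dots> \<pi> \<longleftrightarrow> (\<forall>i. \<exists>j<length ?ls. \<pi> i = set (?ls ! j))" for \<pi>
    by metis
  also have "\<dots> \<pi> \<longleftrightarrow> (\<forall>i. \<pi> i \<in> set ` set ?ls)" for \<pi>
    unfolding image_iff Bex_def in_set_conv_nth by blast
  finally show ?thesis unfolding Pow by auto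
qed

text \<open>The constants 3 and 4 are the tags of \<open>Or\<close> and \<open>Next\<close> in
  \<open>enc_form\<close>; \<open>Proj 1\<close> is the code from the previous recursion
  step.\<close>

definition not_first_recf :: "nat \<Rightarrow> recf" where
  "not_first_recf p = Pr (const_recf (enc_form (Neg (Prop p))))
     (pair_recf (const_recf 3) (pair_recf (const_recf (enc_form (Prop p)))
       (pair_recf (const_recf 4) (Proj 1))))"

lemma reval_not_first: "reval (not_first_recf p) [n] (enc_form (Not_first p n))"
proof (induction n)
  case 0
  then show ?case by (simp add: not_first_recf_def reval_Pr_0_iff reval_const del: enc_form.simps)
next
  case (Suc n)
  have "reval (Proj 1) [n, enc_form (Not_first p n)] (enc_form (Not_first p n))"
    by (simp add: reval_Proj_iff)
  note reval_pair[OF reval_const[of 3] reval_pair[OF reval_const[of "enc_form (Prop p)"]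
      reval_pair[OF reval_const[of 4] this]]]
  then have "reval (pair_recf (const_recf 3) (pair_recf (const_recf (enc_form (Prop p)))
       (pair_recf (const_recf 4) (Proj 1)))) [n, enc_form (Not_first p n)] (enc_form (Not_first p (Suc n)))"
    by simp
  with Suc show ?case unfolding not_first_recf_def reval_Pr_Suc_iff by blast
qed

text \<open>Self-application: the second argument is both the code of the formula to extend and the
  input number for register 1.\<close>

definition input_recf :: recf where
  "input_recf = pair_recf (const_recf 3) (pair_recf (Cn (not_first_recf 2) [Cn Sf [Proj 0]])
     (pair_recf (const_recf 3) (pair_recf (Cn (not_first_recf 3) [Cn Sf [Proj 1]]) (Proj 1))))"

lemma reval_input: "reval input_recf [a, enc_form \<phi>] (enc_form (input_form a (enc_form \<phi>) \<phi>))"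
proof -
  let ?xs = "[a, enc_form \<phi>]"
  have 0: "reval (Proj 0) ?xs a" and 1: "reval (Proj 1) ?xs (enc_form \<phi>)"
    by (simp_all add: reval_Proj_iff)
  have nf: "reval (Cn (not_first_recf p) [Cn Sf [Proj i]]) ?xs (enc_form (Not_first p (Suc x)))"
    if "reval (Proj i) ?xs x" for p i x
    by (intro reval_Cn1[OF reval_Cn1[OF that reval.succ]] reval_not_first)
  show ?thesis
    unfolding input_recf_def input_form_def enc_form.simps(4)
    by (intro reval_pair reval_const nf 0 1)
qed

text \<open>Each \<open>Cn Sf\<close> around a pairing is one cons of \<open>list_encode\<close>;
  the constant tail is the threshold 1/2.\<close>

definition instance_recf :: recf where
  "instance_recf = Cn Sf [pair_recf (Proj 0)
     (Cn Sf [pair_recf input_recf (const_recf (list_encode [1, 2]))])]"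

lemma reval_instance:
  "reval instance_recf [enc_kripke K, enc_form \<phi>]
    (enc_instance K (input_form (enc_kripke K) (enc_form \<phi>) \<phi>) 1 2)"
proof -
  have 0: "reval (Proj 0) [enc_kripke K, enc_form \<phi>] (enc_kripke K)"
    by (simp add: reval_Proj_iff)
  show ?thesis
    unfolding instance_recf_def enc_instance_def list_encode.simps(2)[of "enc_kripke K"]
      list_encode.simps(2)[of "enc_form _"]
    by (intro reval_Cn1[OF _ reval.succ] reval_pair 0 reval_input reval_const)
qed

section \<open>The diagonal argument\<close>

context discounted
begin

text \<open>A common lower bound of the values bounds their infimum, so the infimum need not be
  attained.\<close>

lemma half_le_kval_iff:
  "1 / 2 \<le> kval nm (full_kripke N) \<phi> \<longleftrightarrow> (\<forall>\<pi>. (\<forall>i. \<pi> i \<subseteq> {..<N}) \<longrightarrow> flag \<phi> \<pi>)"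
proof -
  have "(\<lambda>_. {}) \<in> computations (full_kripke N)" by (simp add: computations_full_kripke)
  then have ne: "computations (full_kripke N) \<noteq> {}" by blast
  have bdd: "bdd_below ((\<lambda>\<pi>. val \<pi> \<phi>) ` computations (full_kripke N))"
    by (intro bdd_belowI2[of _ 0] val_ge_0)
  have "1 / 2 \<le> kval nm (full_kripke N) \<phi> \<longleftrightarrow>
      (\<forall>\<pi>\<in>computations (full_kripke N). 1 / 2 \<le> val \<pi> \<phi>)"
    unfolding kval_def le_cINF_iff[OF ne bdd, symmetric] using ne by simp
  then show ?thesis unfolding computations_full_kripke flag_def by blast
qed

lemma half_le_kval_iff_no_run:
  assumes "bounded_regs k E"
  shows "1 / 2 \<le> kval nm (full_kripke (k + 2)) (input_form a b (main_form E k)) \<longleftrightarrow>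
    (\<nexists>s'. ((0, input_store a b), (1, s')) \<in> (estep E)\<^sup>*)"
proof -
  have "(\<exists>s'. ((0, input_store a b), (1, s')) \<in> (estep E)\<^sup>*) \<longleftrightarrow>
      (\<exists>\<pi>. (\<forall>i. \<pi> i \<subseteq> {..<k + 2}) \<and> \<not> flag (input_form a b (main_form E k)) \<pi>)"
    by (intro iffI; elim exE conjE) (rule input_form_complete[OF assms] input_form_sound[OF assms]; assumption)+
  then show ?thesis unfolding half_le_kval_iff by blast
qed

lemma undecidable:
  "\<exists>K \<phi>. wf_kripke K \<and>
    \<not> reval f [enc_instance K \<phi> 1 2] (if 1 / 2 \<le> kval nm K \<phi> then 1 else 0)"
proof -
  \<comment> \<open>Registers 0 and 1 hold the inputs and 2 the answer of \<open>f\<close>. The tail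
    puts 1 into register 3 and compares, so a run gets through iff the answer is 1.\<close>
  define \<alpha> where "\<alpha> = rcomp (Cn f [instance_recf]) [0, 1] 2 3 ;; Act (Zero 3) ;; Act (Inc 3) ;; Act (Eq 3 2)"
  define E where "E = edges \<alpha> 0 1 2"
  obtain k where k: "bounded_regs k E" using bounded_regs_exists by blast
  define K where "K = full_kripke (k + 2)"
  \<comment> \<open>\<open>K\<close> and \<open>main_form E k\<close> are fixed before any input is
    chosen, so their codes may serve as the inputs of the very program they describe.\<close>
  define a b where "a = enc_kripke K" and "b = enc_form (main_form E k)"
  define \<phi> where "\<phi> = input_form a b (main_form E k)"
  have I: "implements (rcomp (Cn f [instance_recf]) [0, 1] 2 3) (reval (Cn f [instance_recf])) [0, 1] 2 3"
    by (intro correctD correct) auto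
  have run: "(\<exists>s'. ((0, input_store a b), (1, s')) \<in> (estep E)\<^sup>*) \<longleftrightarrow>
      (\<exists>s'. (input_store a b, s') \<in> psem \<alpha>)"
    unfolding E_def using edges_sound edges_complete by blast
  have test: "(\<exists>s'. (s, s') \<in> psem (Act (Zero 3) ;; Act (Inc 3) ;; Act (Eq 3 2))) \<longleftrightarrow> s 2 = 1" for s
    by (auto simp: relcomp_unfold)
  have "(\<exists>s'. (input_store a b, s') \<in> psem \<alpha>) \<longleftrightarrow>
      (\<exists>s. (input_store a b, s) \<in> psem (rcomp (Cn f [instance_recf]) [0, 1] 2 3) \<and> s 2 = 1)"
    unfolding \<alpha>_def psem.simps(2)[of "rcomp f rs r m" for f rs r m] test[symmetric] by blast
  also have "\<dots> \<longleftrightarrow> reval (Cn f [instance_recf]) (map (input_store a b) [0, 1]) 1"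
  proof
    assume "\<exists>s. (input_store a b, s) \<in> psem (rcomp (Cn f [instance_recf]) [0, 1] 2 3) \<and> s 2 = 1"
    then show "reval (Cn f [instance_recf]) (map (input_store a b) [0, 1]) 1"
      using implements_sound(1)[OF I] by metis
  next
    assume "reval (Cn f [instance_recf]) (map (input_store a b) [0, 1]) 1"
    from implements_complete[of _ "reval (Cn f [instance_recf])", OF I this] obtain s
      where s: "(input_store a b, s) \<in> psem (rcomp (Cn f [instance_recf]) [0, 1] 2 3)"
        "agree 3 s ((input_store a b)(2 := 1))" .
    from agreeD[OF s(2), of 2] have "s 2 = 1" by simp
    with s(1) show "\<exists>s. (input_store a b, s) \<in> psem (rcomp (Cn f [instance_recf]) [0, 1] 2 3) \<and> s 2 = 1"
      by blast
  qed
  also have "map (input_store a b) [0, 1] = [a, b]" by (simp add: input_store_def)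
  \<comment> \<open>\<open>instance_recf\<close> sends these codes to the instance that asks about
    the run on \<open>a\<close> and \<open>b\<close> themselves.\<close>
  also have "reval (Cn f [instance_recf]) [a, b] 1 \<longleftrightarrow> reval f [enc_instance K \<phi> 1 2] 1"
    using reval_instance[of K "main_form E k"] reval_det
    unfolding a_def[symmetric] b_def[symmetric] \<phi>_def[symmetric]
    by (auto simp: reval_Cn_iff list_all2_Cons1)
  finally have "1 / 2 \<le> kval nm K \<phi> \<longleftrightarrow> \<not> reval f [enc_instance K \<phi> 1 2] 1"
    unfolding K_def \<phi>_def half_le_kval_iff_no_run[OF k] using run by simp
  \<comment> \<open>If the value is at least 1/2, then \<open>f\<close> does not answer 1; otherwise
    it answers 1 and, being single-valued, not 0.\<close>
  then have "\<not> reval f [enc_instance K \<phi> 1 2] (if 1 / 2 \<le> kval nm K \<phi> then 1 else 0)"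
    by (auto dest: reval_det)
  moreover have "wf_kripke K" by (simp add: K_def wf_full_kripke)
  ultimately show ?thesis by blast
qed

end

theorem theorem7:
  fixes D :: "(nat \<Rightarrow> real) set"
    and nm :: "nat \<Rightarrow> nat \<Rightarrow> real"
  assumes "D \<noteq> {}"
    and "\<forall>\<eta>\<in>D. discounting \<eta>"
    and "range nm \<subseteq> D"
  shows "\<not> (\<exists>f. \<forall>K \<phi> p q. wf_kripke K \<and> 0 < q \<and> p \<le> q \<longrightarrow>
            reval f [enc_instance K \<phi> p q]
              (if real p / real q \<le> kval nm K \<phi> then 1 else 0))"
proof
  interpret discounted nm
    by unfold_locales (use assms(2,3) in blast)
  assume "\<exists>f. \<forall>K \<phi> p q. wf_kripke K \<and> 0 < q \<and> p \<le> q \<longrightarrow>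
            reval f [enc_instance K \<phi> p q]
              (if real p / real q \<le> kval nm K \<phi> then 1 else 0)"
  then obtain f where f: "\<And>K \<phi> p q. wf_kripke K \<Longrightarrow> 0 < q \<Longrightarrow> p \<le> q \<Longrightarrow>
      reval f [enc_instance K \<phi> p q] (if real p / real q \<le> kval nm K \<phi> then 1 else 0)"
    by blast
  from undecidable[of f] obtain K \<phi> where "wf_kripke K"
    "\<not> reval f [enc_instance K \<phi> 1 2] (if 1 / 2 \<le> kval nm K \<phi> then 1 else 0)" by blast
  with f[of K 2 1 \<phi>] show False by simp
qed

end
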